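(* In the general cut-and-choose setting described in the context (Protocol 2), assume $N\ge1$. Let $\varepsilon_H,\varepsilon_D\ge0$ be such that, for input $\psi=|+\rangle\langle+|^{\otimes k}$ and $U=\mathbb{1}_{\mathcal{X}}$, $$\tfrac12\|\rho_H-|+\rangle\langle+|^{\otimes k}\|_1\le\varepsilon_H$$ and, for every $\alpha\in\mathbb{R}$ (attack placement fixed), $$\min_{p\in[0,1]}\tfrac12\big\|\rho^\alpha_D-(p|+\rangle\langle+|^{\otimes k}+(1-p)|\bot\rangle\langle\bot|)\big\|_1\le\varepsilon_D .$$ Then $\varepsilon_H+\varepsilon_D\ge\frac{1}{4N}$.
   Context: General cut-and-choose setting. Fix $k\ge1$, $\mathcal{X}=\mathbb{C}^{2^k}$, $P(\alpha)=\mathrm{diag}(1,e^{i\alpha})$, $A_\alpha=\mathbb{1}_2^{\otimes(k-1)}\otimes P(\alpha)$, $|+\rangle=(|0\rangle+|1\rangle)/\sqrt2$, $|+_\alpha\rangle=(|0\rangle+e^{i\alpha}|1\rangle)/\sqrt2$. Let $\Omega$ be a probability distribution on $\mathbb{N}$ (number $n$ of test rounds) with finite mean $N$, and $\omega_n$ a distribution on $\{1,\dots,n+1\}$ (output round $\ell$). For each $n$ there are test unitaries $T_1,\dots,T_n\in\mathrm{U}(\mathcal{X})$. For each $(n,\ell)$: an integer $W$, an auxiliary space $\mathcal{Y}$, a test state $\chi_n$ on $\mathcal{X}^{\otimes W}\otimes\mathcal{Y}$, an accept operator $0\le\mu_{n,k,\ell}\le\mathbb{1}$ on $\mathcal{X}^{\otimes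 W}\otimes\mathcal{Y}$, and an $n$-comb $\mathfrak{B}(V_1,\dots,V_n)=\mathcal{E}_n\circ(\mathcal{V}_n\otimes\mathrm{id})\circ\mathcal{E}_{n-1}\circ\cdots\circ\mathcal{E}_1\circ(\mathcal{V}_1\otimes\mathrm{id})\circ\mathcal{E}_0$ (fixed channels $\mathcal{E}_j$ with memory, $\mathcal{V}_i(\rho)=V_i\rho V_i^\dagger$) producing a channel on $\mathcal{X}^{\otimes W}$. The client's computation round uses a separate register; on acceptance the client outputs the computation output, otherwise $|\bot\rangle$, a unit vector orthogonal to $\mathcal{X}$. The phase attack replaces each $T_i$ by $T^\alpha_i=T_iA_\alpha$ (all $i$) or $T^\alpha_i=A_\alpha T_i$ (all $i$), and likewise applies $A_\alpha$ in the computation round. With $p^H_{n,\ell}=\mathrm{Tr}[\mu_{n,k,\ell}(\mathfrak{B}(T_1,\dots,T_n)\otimes\mathrm{id}_\mathcal{Y})(\chi_n)]$, $p^D_{n,\ell}$ the same with $T^\alpha_i$, $p_H=\sum_n\Omega(n)\sum_\ell\omega_n(\ell)p^H_{n,\ell}$, $p^\alpha_D=\sum_n\Omega(n)\sum_\ell\omega_n(\ell)p^D_{n,\ell}$, the client's outputs for input $|+\rangle\langle+|^{\otimes k}$, $U=\mathbb{1}$ are $\rho_H=p_H|+\rangle\langle+|^{\otimes k}+(1-p_H)|\bot\rangle\langle\bot|$ and $\rho^\alpha_D=p^\alpha_D|+\rangle\langle+|^{\otimes(k-1)}\otimes|+_\alpha\rangle\langle+_\alpha|+(1-p^\alpha_D)|\bot\rangle\langle\bot|$.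 The trace-distance conditions are implied by composable $\varepsilon_H$-correctness and $\varepsilon_D$-security with respect to the ideal VDQC resource (output $U(\psi)$ if the server's bit $c=0$, $\bot$ if $c=1$). *)

theory Defs
  imports "HOL-Probability.Probability" "Jordan_Normal_Form.Matrix"
begin

definition dag :: "complex mat \<Rightarrow> complex mat" where
  "dag A = mat (dim_col A) (dim_row A) (\<lambda>(i,j). cnj (A $$ (j,i)))"

definition mtrace :: "complex mat \<Rightarrow> complex" where
  "mtrace A = (\<Sum>i<dim_row A. A $$ (i,i))"

(* Kronecker (tensor) product; the right factor is the less significant index *)
definition kron :: "complex mat \<Rightarrow> complex mat \<Rightarrow> complex mat" where
  "kron A B = mat (dim_row A * dim_row B) (dim_col A * dim_col B)
     (\<lambda>(i,j). A $$ (i div dim_row B, j div dim_col B) * B $$ (i mod dim_row B, j mod dim_col B))"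

fun tpow :: "nat \<Rightarrow> complex mat \<Rightarrow> complex mat" where
  "tpow 0 A = 1\<^sub>m 1"
| "tpow (Suc m) A = kron (tpow m A) A"

definition unitary :: "nat \<Rightarrow> complex mat \<Rightarrow> bool" where
  "unitary d U \<longleftrightarrow> U \<in> carrier_mat d d \<and> dag U * U = 1\<^sub>m d \<and> U * dag U = 1\<^sub>m d"

definition psd :: "nat \<Rightarrow> complex mat \<Rightarrow> bool" where
  "psd d A \<longleftrightarrow> A \<in> carrier_mat d d \<and> dag A = A \<and>
     (\<forall>v \<in> carrier_vec d. 0 \<le> Re (conjugate v \<bullet> (A *\<^sub>v v)) \<and> Im (conjugate v \<bullet> (A *\<^sub>v v)) = 0)"

definition density :: "nat \<Rightarrow> complex mat \<Rightarrow> bool" where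
  "density d \<rho> \<longleftrightarrow> psd d \<rho> \<and> mtrace \<rho> = 1"

definition effect :: "nat \<Rightarrow> complex mat \<Rightarrow> bool" where
  "effect d M \<longleftrightarrow> psd d M \<and> psd d (1\<^sub>m d - M)"

(* trace norm ||A||_1 = Tr sqrt(A\<^sup>\<dagger> A), sqrt = the unique PSD square root *)
definition trace_norm :: "complex mat \<Rightarrow> real" where
  "trace_norm A = Re (mtrace (THE P. psd (dim_col A) P \<and> P * P = dag A * A))"

definition kraus_channel :: "nat \<Rightarrow> nat \<Rightarrow> complex mat list \<Rightarrow> bool" where
  "kraus_channel din dout Ks \<longleftrightarrow> (\<forall>K \<in> set Ks. K \<in> carrier_mat dout din) \<and>
     foldr (\<lambda>K acc. dag K * K + acc) Ks (0\<^sub>m din din) = 1\<^sub>m din"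

definition apply_kraus :: "nat \<Rightarrow> complex mat list \<Rightarrow> complex mat \<Rightarrow> complex mat" where
  "apply_kraus dout Ks \<rho> = foldr (\<lambda>K acc. K * \<rho> * dag K + acc) Ks (0\<^sub>m dout dout)"

definition apply_kraus_Y :: "nat \<Rightarrow> nat \<Rightarrow> complex mat list \<Rightarrow> complex mat \<Rightarrow> complex mat" where
  "apply_kraus_Y dY dout Ks \<rho> = apply_kraus (dout * dY) (map (\<lambda>K. kron K (1\<^sub>m dY)) Ks) \<rho>"

definition conj_left :: "complex mat \<Rightarrow> complex mat \<Rightarrow> complex mat" where
  "conj_left V \<rho> = (let U = kron V (1\<^sub>m (dim_row \<rho> div dim_row V)) in U * \<rho> * dag U)"

(* Partial evaluation of the comb tensored with id_Y:
   comb_part ... j \<rho> = (E_j \<circ> (V_j \<otimes> id) \<circ> \<dots> \<circ> E_1 \<circ> (V_1 \<otimes> id) \<circ> E_0 \<otimes> id_Y)(\<rho>).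
   Es j : Kraus operators of E_j; odim j : output dimension of E_j. *)
fun comb_part :: "nat \<Rightarrow> (nat \<Rightarrow> complex mat list) \<Rightarrow> (nat \<Rightarrow> nat) \<Rightarrow> (nat \<Rightarrow> complex mat)
                   \<Rightarrow> nat \<Rightarrow> complex mat \<Rightarrow> complex mat" where
  "comb_part dY Es odim Vs 0 \<rho> = apply_kraus_Y dY (odim 0) (Es 0) \<rho>"
| "comb_part dY Es odim Vs (Suc j) \<rho> =
     apply_kraus_Y dY (odim (Suc j)) (Es (Suc j)) (conj_left (Vs (Suc j)) (comb_part dY Es odim Vs j \<rho>))"

definition comb_apply :: "nat \<Rightarrow> nat \<Rightarrow> (nat \<Rightarrow> complex mat list) \<Rightarrow> (nat \<Rightarrow> nat)
                          \<Rightarrow> (nat \<Rightarrow> complex mat) \<Rightarrow> complex mat \<Rightarrow> complex mat" where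
  "comb_apply n dY Es odim Vs \<rho> = comb_part dY Es odim Vs n \<rho>"

(* well-formed n-comb on X^{\<otimes>W} (X = C^{2^k}) with memory dimensions D 1, ..., D n:
   E_0 : X^{\<otimes>W} \<rightarrow> X \<otimes> M_1,  E_j : X \<otimes> M_j \<rightarrow> X \<otimes> M_{j+1},  E_n : X \<otimes> M_n \<rightarrow> X^{\<otimes>W} *)
definition comb_odim :: "nat \<Rightarrow> nat \<Rightarrow> nat \<Rightarrow> (nat \<Rightarrow> nat) \<Rightarrow> nat \<Rightarrow> nat" where
  "comb_odim k W n D j = (if j < n then 2^k * D (Suc j) else 2^(k*W))"

definition comb_idim :: "nat \<Rightarrow> nat \<Rightarrow> (nat \<Rightarrow> nat) \<Rightarrow> nat \<Rightarrow> nat" where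
  "comb_idim k W D j = (if j = 0 then 2^(k*W) else 2^k * D j)"

definition wf_comb :: "nat \<Rightarrow> nat \<Rightarrow> nat \<Rightarrow> (nat \<Rightarrow> nat) \<Rightarrow> (nat \<Rightarrow> complex mat list) \<Rightarrow> bool" where
  "wf_comb k W n D Es \<longleftrightarrow> (\<forall>j\<le>n. kraus_channel (comb_idim k W D j) (comb_odim k W n D j) (Es j))"

definition accept_prob :: "nat \<Rightarrow> nat \<Rightarrow> nat \<Rightarrow> nat \<Rightarrow> (nat \<Rightarrow> nat) \<Rightarrow> (nat \<Rightarrow> complex mat list)
      \<Rightarrow> complex mat \<Rightarrow> complex mat \<Rightarrow> (nat \<Rightarrow> complex mat) \<Rightarrow> real" where
  "accept_prob k n W dY D Es \<mu> \<sigma> Vs = Re (mtrace (\<mu> * comb_apply n dY Es (comb_odim k W n D) Vs \<sigma>))"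

definition ket_plus :: "complex mat" where
  "ket_plus = mat 2 1 (\<lambda>(i,j). complex_of_real (1 / sqrt 2))"

definition ket_plus_alpha :: "real \<Rightarrow> complex mat" where
  "ket_plus_alpha \<alpha> = mat 2 1 (\<lambda>(i,j). if i = 0 then complex_of_real (1 / sqrt 2)
                                         else cis \<alpha> * complex_of_real (1 / sqrt 2))"

definition proj :: "complex mat \<Rightarrow> complex mat" where
  "proj v = v * dag v"

definition phase_gate :: "real \<Rightarrow> complex mat" where
  "phase_gate \<alpha> = mat 2 2 (\<lambda>(i,j). if i = j then (if i = 0 then 1 else cis \<alpha>) else 0)"

definition A_gate :: "nat \<Rightarrow> real \<Rightarrow> complex mat" where
  "A_gate k \<alpha> = kron (tpow (k - 1) (1\<^sub>m 2)) (phase_gate \<alpha>)"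

(* Output space X \<oplus> span{|\<bottom>\<rangle>} of dimension 2^k + 1; |\<bottom>\<rangle> is the last basis vector *)
definition embX :: "nat \<Rightarrow> complex mat \<Rightarrow> complex mat" where
  "embX k \<rho> = four_block_mat \<rho> (0\<^sub>m (2^k) 1) (0\<^sub>m 1 (2^k)) (0\<^sub>m 1 1)"

definition bot_proj :: "nat \<Rightarrow> complex mat" where
  "bot_proj k = four_block_mat (0\<^sub>m (2^k) (2^k)) (0\<^sub>m (2^k) 1) (0\<^sub>m 1 (2^k)) (1\<^sub>m 1)"

definition out_state :: "nat \<Rightarrow> real \<Rightarrow> complex mat \<Rightarrow> complex mat" where
  "out_state k p \<sigma> = complex_of_real p \<cdot>\<^sub>m embX k \<sigma> + complex_of_real (1 - p) \<cdot>\<^sub>m bot_proj k"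

definition plus_k :: "nat \<Rightarrow> complex mat" where
  "plus_k k = proj (tpow k ket_plus)"

definition plus_k_alpha :: "nat \<Rightarrow> real \<Rightarrow> complex mat" where
  "plus_k_alpha k \<alpha> = kron (proj (tpow (k - 1) ket_plus)) (proj (ket_plus_alpha \<alpha>))"

end

theory Submission
  imports Defs
begin

text \<open>
  The trace norm of the difference of the two output states is computed exactly from a 2x2 block, and
  gives \<open>1 - p\<^sub>H \<le> \<epsilon>\<^sub>H\<close> and \<open>p\<^sub>D sin (\<alpha> / 2) \<le> \<epsilon>\<^sub>D\<close>.
  As a function of the phase \<open>\<beta>\<close> applied in a single round, with all other rounds fixed, the
  acceptance probability has the form \<open>u + v cos \<beta> + w sin \<beta>\<close> and takes values in \<open>[0,1]\<close> for every
  \<open>\<beta>\<close>; this alone bounds its change from phase 0 to phase \<open>\<alpha>\<close> by \<open>\<bar>sin (\<alpha> / 2)\<bar>\<close>, so no norm estimate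
  for channels is needed. Switching the phase on round by round and averaging yields
  \<open>p\<^sub>H - p\<^sub>D \<le> N sin (\<alpha> / 2)\<close>, and the choice \<open>sin (\<alpha> / 2) = 1 / (2 N)\<close> gives the theorem.
\<close>

unbundle no inner_syntax

section \<open>Matrix algebra\<close>

text \<open>No eigenvalue decomposition is used. \<open>trace_norm\<close> is a definite description
  of a square root, so uniqueness of positive square roots is derived from traces alone, and every
  trace norm is then found by exhibiting the root. Likewise, that acceptance probabilities lie in
  [0,1] rests on \<open>Tr (A B) >= 0\<close> for positive \<open>A\<close> and \<open>B\<close>,
  which Gaussian elimination provides. The outputs differ only in the last qubit and in the weight
  of the rejection state, hence the direct sum of a 2x2 block and a scalar. Among the ideal outputs
  with acceptance probability \<open>p\<close>, the one with \<open>p\<close> equal to the attacked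
  probability \<open>q\<close> is closest, at trace distance \<open>q sin (\<alpha> / 2)\<close>;
  this is why no minimisation over \<open>p\<close> is carried out. With
  \<open>s = sin (\<alpha> / 2)\<close>, the three estimates combine to
  \<open>\<epsilon>D >= s (1 - \<epsilon>H - N s)\<close>. For \<open>\<epsilon>H = 0\<close> the
  right side is largest at \<open>s = 1 / (2 N)\<close>, where it equals \<open>1 / (4 N)\<close>;
  since \<open>s <= 1\<close>, a positive \<open>\<epsilon>H\<close> costs at most
  \<open>\<epsilon>H\<close>. The assumption \<open>N >= 1\<close> keeps \<open>s\<close> in the
  range of the sine.\<close>

lemma dag_carrier [simp, intro]: "A \<in> carrier_mat m n \<Longrightarrow> dag A \<in> carrier_mat n m"
  by (auto simp: dag_def)

lemma dag_dim [simp]: "dim_row (dag A) = dim_col A" "dim_col (dag A) = dim_row A"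
  by (auto simp: dag_def)

lemma dag_index [simp]: "i < dim_col A \<Longrightarrow> j < dim_row A \<Longrightarrow> dag A $$ (i,j) = cnj (A $$ (j,i))"
  by (auto simp: dag_def)

lemma dag_dag [simp]: "dag (dag A) = A"
  by (rule eq_matI) auto

lemma dag_one [simp]: "dag (1\<^sub>m n) = 1\<^sub>m n"
  by (rule eq_matI) auto

lemma index_mult_mat_sum:
  "i < dim_row A \<Longrightarrow> j < dim_col B \<Longrightarrow> dim_col A = dim_row B \<Longrightarrow>
     (A * B) $$ (i,j) = (\<Sum>l<dim_row B. A $$ (i,l) * B $$ (l,j))"
  by (auto simp: scalar_prod_def lessThan_atLeast0 intro!: sum.cong)

lemma mult_mat_assoc_dim:
  fixes A B C :: "complex mat"
  assumes "dim_col A = dim_row B" "dim_col B = dim_row C"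
  shows "A * B * C = A * (B * C)"
  using assms by (intro assoc_mult_mat[of A "dim_row A" "dim_row B" B "dim_row C" C "dim_col C"]) auto

lemma dag_mult: "dim_col A = dim_row B \<Longrightarrow> dag (A * B) = dag B * dag A"
  by (rule eq_matI) (auto simp: index_mult_mat_sum mult.commute simp del: index_mult_mat(1))

lemma dag_add: "A \<in> carrier_mat m n \<Longrightarrow> B \<in> carrier_mat m n \<Longrightarrow> dag (A + B) = dag A + dag B"
  by (rule eq_matI) auto

lemma dag_minus: "A \<in> carrier_mat m n \<Longrightarrow> B \<in> carrier_mat m n \<Longrightarrow> dag (A - B) = dag A - dag B"
  by (rule eq_matI) auto

lemma mtrace_add: "A \<in> carrier_mat n n \<Longrightarrow> B \<in> carrier_mat n n \<Longrightarrow> mtrace (A + B) = mtrace A + mtrace B"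
  by (auto simp: mtrace_def sum.distrib)

lemma mtrace_minus: "A \<in> carrier_mat n n \<Longrightarrow> B \<in> carrier_mat n n \<Longrightarrow> mtrace (A - B) = mtrace A - mtrace B"
  by (auto simp: mtrace_def sum_subtractf)

lemma mtrace_zero [simp]: "mtrace (0\<^sub>m n n) = 0"
  by (auto simp: mtrace_def)

lemma mtrace_mult_sum:
  assumes "A \<in> carrier_mat m n" "B \<in> carrier_mat n m"
  shows "mtrace (A * B) = (\<Sum>i<m. \<Sum>l<n. A $$ (i,l) * B $$ (l,i))"
  using assms by (auto simp: mtrace_def index_mult_mat_sum simp del: index_mult_mat(1) intro!: sum.cong)

lemma mtrace_mult_comm:
  assumes "A \<in> carrier_mat m n" "B \<in> carrier_mat n m"
  shows "mtrace (A * B) = mtrace (B * A)"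
  unfolding mtrace_mult_sum[OF assms] mtrace_mult_sum[OF assms(2,1)]
  by (subst sum.swap) (simp add: mult.commute)

section \<open>Quadratic forms, positive semidefinite matrices and square roots\<close>

definition qform :: "complex mat \<Rightarrow> complex vec \<Rightarrow> complex" where
  "qform A v = conjugate v \<bullet> (A *\<^sub>v v)"

lemma psd_iff_qform:
  "psd d A \<longleftrightarrow> A \<in> carrier_mat d d \<and> dag A = A \<and>
     (\<forall>v \<in> carrier_vec d. 0 \<le> Re (qform A v) \<and> Im (qform A v) = 0)"
  by (simp add: psd_def qform_def)

lemma conjugate_sprod_dag:
  assumes "V \<in> carrier_mat m n" "v \<in> carrier_vec n" "w \<in> carrier_vec m"
  shows "conjugate (V *\<^sub>v v) \<bullet> w = conjugate v \<bullet> (dag V *\<^sub>v w)"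
proof -
  have "conjugate (V *\<^sub>v v) \<bullet> w = (\<Sum>i<m. \<Sum>j<n. cnj (V $$ (i,j)) * cnj (v $ j) * w $ i)"
    using assms by (auto simp: scalar_prod_def lessThan_atLeast0 sum_distrib_right intro!: sum.cong)
  also have "\<dots> = (\<Sum>j<n. \<Sum>i<m. cnj (V $$ (i,j)) * cnj (v $ j) * w $ i)"
    by (rule sum.swap)
  also have "\<dots> = conjugate v \<bullet> (dag V *\<^sub>v w)"
    using assms by (auto simp: scalar_prod_def lessThan_atLeast0 sum_distrib_left mult_ac intro!: sum.cong)
  finally show ?thesis .
qed

lemma qform_congruence:
  assumes "V \<in> carrier_mat m n" "A \<in> carrier_mat m m" "v \<in> carrier_vec n"
  shows "qform (dag V * A * V) v = qform A (V *\<^sub>v v)"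
proof -
  have "(dag V * A * V) *\<^sub>v v = (dag V * A) *\<^sub>v (V *\<^sub>v v)"
    using assms by (intro assoc_mult_mat_vec[of _ n m _ n]) auto
  also have "\<dots> = dag V *\<^sub>v (A *\<^sub>v (V *\<^sub>v v))"
    using assms by (intro assoc_mult_mat_vec[of _ n m _ m]) auto
  finally show ?thesis
    unfolding qform_def using assms by (subst conjugate_sprod_dag[of V m n]) auto
qed

lemma psd_congruence:
  assumes "psd m A" "V \<in> carrier_mat m n"
  shows "psd n (dag V * A * V)"
proof -
  have A: "A \<in> carrier_mat m m" "dag A = A"
    using assms by (auto simp: psd_def)
  have "dag (dag V * A * V) = dag V * A * V"
    using A assms(2) by (simp add: dag_mult assoc_mult_mat[of "dag V" n m A m V n])
  then show ?thesis
    using assms A by (auto simp: psd_iff_qform qform_congruence[of V m n])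
qed

lemma psd_congruence':
  assumes "psd m A" "V \<in> carrier_mat n m"
  shows "psd n (V * A * dag V)"
  using psd_congruence[of m A "dag V" n] assms by simp

lemma qform_add_mat:
  assumes "A \<in> carrier_mat d d" "B \<in> carrier_mat d d" "v \<in> carrier_vec d"
  shows "qform (A + B) v = qform A v + qform B v"
  using assms by (simp add: qform_def add_mult_distrib_mat_vec[of _ d d] scalar_prod_add_distrib[of _ d])

lemma psd_add: "psd d A \<Longrightarrow> psd d B \<Longrightarrow> psd d (A + B)"
  by (auto simp: psd_iff_qform qform_add_mat dag_add[of _ d d])

lemma psd_zero: "psd d (0\<^sub>m d d)"
proof -
  have "dag (0\<^sub>m d d) = 0\<^sub>m d d"
    by (rule eq_matI) auto
  then show ?thesis
    by (auto simp: psd_def scalar_prod_def)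
qed

lemma psd_diag_entry:
  assumes "psd d A" "i < d"
  shows "qform A (unit_vec d i) = A $$ (i,i)" "0 \<le> Re (A $$ (i,i))" "Im (A $$ (i,i)) = 0"
proof -
  have A: "A \<in> carrier_mat d d"
    using assms by (auto simp: psd_def)
  have c: "conjugate (unit_vec d i) = (unit_vec d i :: complex vec)"
    by (rule eq_vecI) (auto simp: unit_vec_def)
  show *: "qform A (unit_vec d i) = A $$ (i,i)"
    using A assms by (simp add: qform_def c)
  show "0 \<le> Re (A $$ (i,i))" "Im (A $$ (i,i)) = 0"
    using assms by (auto simp: psd_iff_qform simp flip: *)
qed

lemma mtrace_psd_nonneg: "psd d A \<Longrightarrow> 0 \<le> Re (mtrace A)"
  using psd_diag_entry[of d A] by (auto simp: mtrace_def psd_def intro!: sum_nonneg)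

text \<open>Variation of \<open>v\<close> in the direction \<open>w = P v\<close>: the form at
  \<open>v - e w\<close> is \<open>e (e q - 2 n)\<close>, where \<open>q\<close> is the form at
  \<open>w\<close> and \<open>n\<close> the squared norm of \<open>w\<close>. For small positive
  \<open>e\<close> this would be negative unless \<open>n = 0\<close>.\<close>

lemma psd_kernel:
  assumes psd: "psd d P" and v: "v \<in> carrier_vec d" and zero: "Re (qform P v) = 0"
  shows "P *\<^sub>v v = 0\<^sub>v d"
proof -
  define w where "w = P *\<^sub>v v"
  have P: "P \<in> carrier_mat d d" "dag P = P"
    using psd by (auto simp: psd_def)
  have w: "w \<in> carrier_vec d" "P *\<^sub>v w \<in> carrier_vec d"
    using P v by (auto simp: w_def)
  define n where "n = Re (conjugate w \<bullet> w)"
  have vPw: "conjugate v \<bullet> (P *\<^sub>v w) = conjugate w \<bullet> w"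
    using conjugate_sprod_dag[of P d d v w] P v w by (simp add: w_def)
  have expand: "Re (qform P (v - of_real e \<cdot>\<^sub>v w)) = e * (e * Re (qform P w) - 2 * n)" for e :: real
  proof -
    define x where "x = P *\<^sub>v w"
    have x: "x \<in> carrier_vec d"
      using w by (simp add: x_def)
    have c: "conjugate (v - of_real e \<cdot>\<^sub>v w) = conjugate v - of_real e \<cdot>\<^sub>v conjugate w"
      using v w by (intro eq_vecI) auto
    have "P *\<^sub>v (v - of_real e \<cdot>\<^sub>v w) = w - of_real e \<cdot>\<^sub>v x"
      using P v w by (simp add: w_def x_def mult_minus_distrib_mat_vec[of _ d d] mult_mat_vec[of _ d d])
    then have "qform P (v - of_real e \<cdot>\<^sub>v w) =
        (conjugate v - of_real e \<cdot>\<^sub>v conjugate w) \<bullet> (w - of_real e \<cdot>\<^sub>v x)"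
      by (simp add: qform_def c)
    also have "\<dots> = conjugate v \<bullet> (w - of_real e \<cdot>\<^sub>v x)
        - of_real e * (conjugate w \<bullet> (w - of_real e \<cdot>\<^sub>v x))"
      using v w(1) x by (subst minus_scalar_prod_distrib[of _ d]) auto
    also have "\<dots> = conjugate v \<bullet> w - of_real e * (conjugate v \<bullet> x)
        - of_real e * (conjugate w \<bullet> w - of_real e * (conjugate w \<bullet> x))"
      using v w(1) x by (simp add: scalar_prod_minus_distrib[of _ d])
    finally have "Re (qform P (v - of_real e \<cdot>\<^sub>v w)) = Re (conjugate v \<bullet> w)
        - e * Re (conjugate v \<bullet> x) - e * (Re (conjugate w \<bullet> w) - e * Re (conjugate w \<bullet> x))"
      by simp
    moreover have "Re (conjugate v \<bullet> w) = 0" "Re (conjugate v \<bullet> x) = n"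
        "Re (conjugate w \<bullet> x) = Re (qform P w)"
      using zero vPw by (simp_all add: w_def x_def qform_def n_def)
    ultimately show ?thesis
      by (simp add: n_def ring_distribs)
  qed
  have "0 \<le> e * (e * Re (qform P w) - 2 * n)" for e
    using psd v w by (simp add: psd_iff_qform flip: expand)
  moreover have n0: "n \<ge> 0"
    using w by (auto simp: n_def scalar_prod_def intro!: sum_nonneg)
  ultimately have "n = 0"
  proof -
    assume *: "\<And>e. 0 \<le> e * (e * Re (qform P w) - 2 * n)"
    let ?q = "Re (qform P w)"
    have q: "?q \<ge> 0" using psd w by (simp add: psd_iff_qform)
    \<comment> \<open>The test value is \<open>e = n / (?q + 1)\<close>: it satisfies
      \<open>e * ?q <= n\<close>, and the added 1 keeps the denominator positive when
      \<open>?q = 0\<close>.\<close>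
    have "n / (?q + 1) * ?q \<le> n"
      using q n0 by (simp add: field_simps)
    then have "n / (?q + 1) * (n / (?q + 1) * ?q - 2 * n) \<le> n / (?q + 1) * (- n)"
      using q n0 by (intro mult_left_mono) auto
    then have "n * n / (?q + 1) \<le> 0"
      using *[of "n / (?q + 1)"] by simp
    then have "n * n \<le> 0"
      using q by (simp add: divide_le_0_iff)
    then show "n = 0"
      by (metis mult_eq_0_iff order_antisym zero_le_square)
  qed
  then have "(\<Sum>i<d. (cmod (w $ i))\<^sup>2) = 0"
    using w by (simp add: n_def scalar_prod_def lessThan_atLeast0 cmod_def power2_eq_square)
  then have "\<forall>i<d. w $ i = 0"
    by (subst (asm) sum_nonneg_eq_0_iff) auto
  then show ?thesis
    using w P by (intro eq_vecI) (auto simp: w_def)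
qed

lemma qform_sum:
  assumes "A \<in> carrier_mat d d" "v \<in> carrier_vec d"
  shows "qform A v = (\<Sum>i<d. \<Sum>j<d. cnj (v $ i) * A $$ (i,j) * v $ j)"
  using assms
  by (auto simp: qform_def scalar_prod_def lessThan_atLeast0 sum_distrib_left mult.assoc intro!: sum.cong)

lemma psd_one: "psd d (1\<^sub>m d)"
  by (auto simp: psd_def scalar_prod_def intro!: sum_nonneg sum.neutral)

text \<open>Symmetric Gaussian elimination of the row and column of a positive pivot: the
  Schur complement stays positive semidefinite.\<close>

lemma psd_schur_complement:
  assumes psd: "psd d A" and m: "m < d" and pivot: "A $$ (m,m) \<noteq> 0"
  shows "psd d (mat d d (\<lambda>(i,j). A $$ (i,j) - A $$ (i,m) * A $$ (m,j) / A $$ (m,m)))"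
    (is "psd d ?S")
proof -
  \<comment> \<open>\<open>C\<close> is the identity except in row \<open>m\<close>. Its entry at
    \<open>(m,m)\<close> is 0 rather than 1, so the congruence also clears the pivot instead of
    leaving it on the diagonal.\<close>
  define C where "C = mat d d (\<lambda>(i,j). (if i = j then 1 else 0) - (if i = m then A $$ (m,j) / A $$ (m,m) else 0))"
  have A: "A \<in> carrier_mat d d" "dag A = A"
    using psd by (auto simp: psd_def)
  have C: "C \<in> carrier_mat d d"
    by (simp add: C_def)
  have AC: "A * C = ?S"
  proof (rule eq_matI)
    fix i j assume "i < dim_row ?S" "j < dim_col ?S"
    then have ij: "i < d" "j < d" by auto
    have "(A * C) $$ (i,j) = (\<Sum>l<d. A $$ (i,l) * C $$ (l,j))"
      using A C ij by (subst index_mult_mat_sum) auto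
    also have "\<dots> = (\<Sum>l<d. (if l = j then A $$ (i,l) else 0) -
        (if l = m then A $$ (i,l) * A $$ (m,j) / A $$ (m,m) else 0))"
      using ij by (intro sum.cong) (auto simp: C_def ring_distribs)
    also have "\<dots> = ?S $$ (i,j)"
      using ij m by (simp add: sum_subtractf)
    finally show "(A * C) $$ (i,j) = ?S $$ (i,j)" .
  qed (use A C in auto)
  \<comment> \<open>\<open>dag C\<close> differs from the identity only in column \<open>m\<close>,
    which meets row \<open>m\<close> of \<open>?S\<close>; that row is zero.\<close>
  have "dag C * ?S = ?S"
  proof (rule eq_matI)
    fix i j assume "i < dim_row ?S" "j < dim_col ?S"
    then have ij: "i < d" "j < d" by auto
    have "(dag C * ?S) $$ (i,j) = (\<Sum>l<d. dag C $$ (i,l) * ?S $$ (l,j))"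
      using C ij by (subst index_mult_mat_sum) auto
    also have "\<dots> = (\<Sum>l<d. if l = i then ?S $$ (l,j) else 0)"
      using ij C pivot by (intro sum.cong) (auto simp: C_def)
    also have "\<dots> = ?S $$ (i,j)"
      using ij by simp
    finally show "(dag C * ?S) $$ (i,j) = ?S $$ (i,j)" .
  qed (use A C in auto)
  then have "dag C * A * C = ?S"
    using A C by (simp add: assoc_mult_mat[of _ d d _ d _ d] AC)
  then show ?thesis
    using psd_congruence[OF psd C] by simp
qed

text \<open>A diagonal entry is the form at a unit vector, so if it vanishes,
  \<open>psd_kernel\<close> puts that vector into the kernel. This clears column \<open>m\<close>,
  and hermiticity clears row \<open>m\<close>.\<close>

lemma psd_zero_diag_entry:
  assumes "psd d A" "m < d" "A $$ (m,m) = 0" "i < d"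
  shows "A $$ (i,m) = 0" "A $$ (m,i) = 0"
proof -
  have A: "A \<in> carrier_mat d d" "dag A = A"
    using assms by (auto simp: psd_def)
  have "A *\<^sub>v unit_vec d m = 0\<^sub>v d"
    using assms psd_diag_entry(1)[of d A m] by (intro psd_kernel) auto
  then have "(A *\<^sub>v unit_vec d m) $ i = 0"
    using assms by simp
  then show *: "A $$ (i,m) = 0"
    using A assms by simp
  have "A $$ (m,i) = dag A $$ (m,i)"
    using A by simp
  then show "A $$ (m,i) = 0"
    using A(1) assms * by simp
qed

text \<open>Induction on the number of leading rows of \<open>A\<close> that may be nonzero. A
  nonzero pivot \<open>a\<close> splits \<open>A\<close> into its Schur complement \<open>S\<close>
  and the rank-one matrix \<open>v v^dagger / a\<close> built from the pivot column
  \<open>v\<close>. The rank-one part contributes \<open>qform B v / a\<close> to the trace, and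
  \<open>S\<close> has one possibly nonzero row fewer. A zero pivot already has a zero row.\<close>

lemma mtrace_psd_mult_nonneg:
  assumes A: "psd d A" and B: "psd d B"
  shows "0 \<le> Re (mtrace (A * B))"
proof -
  have Bc: "B \<in> carrier_mat d d"
    using B by (simp add: psd_def)
  have "0 \<le> Re (mtrace (A * B))"
    if "psd d A" "\<And>i j. i < d \<Longrightarrow> j < d \<Longrightarrow> m \<le> i \<Longrightarrow> A $$ (i,j) = 0" for m A
    using that
  proof (induction m arbitrary: A)
    case 0
    then have "mtrace (A * B) = 0"
      using Bc by (subst mtrace_mult_sum[of _ d d]) (auto simp: psd_def)
    then show ?case by simp
  next
    case (Suc m)
    have Ac: "A \<in> carrier_mat d d" "dag A = A"
      using Suc.prems by (auto simp: psd_def)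
    consider "d \<le> m" | "m < d" "A $$ (m,m) = 0" | "m < d" "A $$ (m,m) \<noteq> 0"
      by linarith
    then show ?case
    proof cases
      case 1
      then show ?thesis
        using Suc.prems by (intro Suc.IH) auto
    next
      case 2
      show ?thesis
      proof (rule Suc.IH)
        fix i j assume "i < d" "j < d" "m \<le> i"
        then show "A $$ (i,j) = 0"
          using psd_zero_diag_entry(2)[OF Suc.prems(1) 2, of j] Suc.prems(2)[of i j]
          by (cases "i = m") auto
      qed (rule Suc.prems)
    next
      case 3
      define a where "a = A $$ (m,m)"
      define S where "S = mat d d (\<lambda>(i,j). A $$ (i,j) - A $$ (i,m) * A $$ (m,j) / a)"
      define v where "v = vec d (\<lambda>i. A $$ (i,m))"
      have S: "psd d S"
        unfolding S_def a_def by (rule psd_schur_complement) (use Suc.prems 3 in auto)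
      have a: "Im a = 0" "0 \<le> Re a"
        using psd_diag_entry[OF Suc.prems(1), of m] 3 by (auto simp: a_def)
      have S0: "0 \<le> Re (mtrace (S * B))"
      proof (rule Suc.IH[OF S])
        fix i j assume "i < d" "j < d" "m \<le> i"
        then show "S $$ (i,j) = 0"
          using Suc.prems(2)[of i j] Suc.prems(2)[of i m] 3 by (cases "i = m") (auto simp: S_def a_def)
      qed
      have q: "qform B v = (\<Sum>i<d. \<Sum>l<d. A $$ (i,m) * A $$ (m,l) * B $$ (l,i))"
      proof -
        have cnj_v: "cnj (v $ l) = A $$ (m,l)" if "l < d" for l
        proof -
          have "A $$ (m,l) = dag A $$ (m,l)"
            using Ac by simp
          then show ?thesis
            using Ac(1) that 3 by (simp add: v_def)
        qed
        have "qform B v = (\<Sum>l<d. \<Sum>i<d. cnj (v $ l) * B $$ (l,i) * v $ i)"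
          using Bc by (intro qform_sum) (auto simp: v_def)
        also have "\<dots> = (\<Sum>l<d. \<Sum>i<d. A $$ (i,m) * A $$ (m,l) * B $$ (l,i))"
          by (intro sum.cong) (auto simp: cnj_v, auto simp: v_def)
        finally show ?thesis
          by (subst sum.swap)
      qed
      have "mtrace (A * B) = (\<Sum>i<d. \<Sum>l<d. S $$ (i,l) * B $$ (l,i) + A $$ (i,m) * A $$ (m,l) * B $$ (l,i) / a)"
        using Ac Bc by (subst mtrace_mult_sum[of _ d d]) (auto simp: S_def ring_distribs intro!: sum.cong)
      also have "\<dots> = mtrace (S * B) + qform B v / a"
        using S Bc by (subst mtrace_mult_sum[of _ d d])
          (auto simp: psd_def q sum.distrib sum_divide_distrib)
      finally have "Re (mtrace (A * B)) = Re (mtrace (S * B)) + Re (qform B v / a)"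
        by simp
      moreover have "0 \<le> Re (qform B v / a)"
      proof -
        have "a = of_real (Re a)"
          using a by (simp add: complex_eq_iff)
        then have "Re (qform B v / a) = Re (qform B v) / Re a"
          by (metis Re_divide_of_real)
        moreover have "0 \<le> Re (qform B v)"
          using B by (auto simp: psd_iff_qform v_def)
        ultimately show ?thesis
          using a by simp
      qed
      ultimately show ?thesis
        using S0 by simp
    qed
  qed
  from this[OF A, of d] show ?thesis
    by simp
qed

text \<open>The diagonal entries of \<open>dag R * P * R\<close> are the forms of \<open>P\<close>
  at the columns of \<open>R\<close>. They are nonnegative with sum zero, so each vanishes and
  \<open>psd_kernel\<close> applies column by column.\<close>

lemma psd_mult_eq_zero:
  assumes P: "psd d P" and R: "R \<in> carrier_mat d n" and zero: "Re (mtrace (dag R * P * R)) = 0"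
  shows "P * R = 0\<^sub>m d n"
proof -
  have Pc: "P \<in> carrier_mat d d"
    using P by (simp add: psd_def)
  have psd: "psd n (dag R * P * R)"
    by (rule psd_congruence[OF P R])
  have "(\<Sum>i<n. Re ((dag R * P * R) $$ (i,i))) = 0"
    using zero R by (simp add: mtrace_def)
  then have diag: "\<forall>i<n. Re ((dag R * P * R) $$ (i,i)) = 0"
    using psd_diag_entry(2)[OF psd] by (subst (asm) sum_nonneg_eq_0_iff) auto
  have "col (P * R) i = 0\<^sub>v d" if "i < n" for i
  proof -
    have "qform P (R *\<^sub>v unit_vec n i) = (dag R * P * R) $$ (i,i)"
      using qform_congruence[OF R Pc, of "unit_vec n i"] psd_diag_entry(1)[OF psd that] by simp
    then have "P *\<^sub>v (R *\<^sub>v unit_vec n i) = 0\<^sub>v d"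
      using diag that R by (intro psd_kernel[OF P]) auto
    moreover have "R *\<^sub>v unit_vec n i = col R i"
      using R that by (intro eq_vecI) auto
    moreover have "col (P * R) i = P *\<^sub>v col R i"
      using Pc R that by (intro eq_vecI) auto
    ultimately show ?thesis by simp
  qed
  then show ?thesis
    using Pc R by (intro mat_col_eqI) auto
qed

text \<open>For \<open>R = P - Q\<close> one has \<open>P R + R Q = P P - Q Q = 0\<close>.
  Multiplying by \<open>R\<close> and taking traces, the nonnegative traces of \<open>R P R\<close>
  and \<open>R Q R\<close> add up to zero; hence \<open>P R = Q R = 0\<close>, so
  \<open>R R = 0\<close> and \<open>R = 0\<close>.\<close>

lemma psd_sqrt_unique:
  assumes P: "psd d P" and Q: "psd d Q" and eq: "P * P = Q * Q"
  shows "P = Q"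
proof -
  define R where "R = P - Q"
  have c: "P \<in> carrier_mat d d" "Q \<in> carrier_mat d d" "dag P = P" "dag Q = Q"
    using P Q by (auto simp: psd_def)
  have R: "R \<in> carrier_mat d d" "dag R = R"
    using c by (auto simp: R_def dag_minus[of _ d d])
  have PR: "P * R + R * Q = 0\<^sub>m d d"
  proof -
    have "P * R + R * Q = (P * P - P * Q) + (P * Q - Q * Q)"
      using c by (simp add: R_def mult_minus_distrib_mat[of _ d d] minus_mult_distrib_mat[of _ d d])
    also have "\<dots> = 0\<^sub>m d d"
      using c eq by (intro eq_matI) auto
    finally show ?thesis .
  qed
  have "mtrace (R * P * R) + mtrace (R * Q * R) = mtrace (R * (P * R)) + mtrace (R * (R * Q))"
    using c R mtrace_mult_comm[of R d d "R * Q"] by (simp add: assoc_mult_mat[of _ d d _ d _ d])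
  also have "\<dots> = mtrace (R * (P * R + R * Q))"
    using c R by (simp add: mult_add_distrib_mat[of R d d "P * R" d "R * Q"] mtrace_add[of _ d])
  also have "\<dots> = 0"
    using R by (simp add: PR)
  finally have "Re (mtrace (R * P * R)) + Re (mtrace (R * Q * R)) = 0"
    by (metis plus_complex.sel(1) zero_complex.sel(1))
  moreover have "0 \<le> Re (mtrace (R * P * R))" "0 \<le> Re (mtrace (R * Q * R))"
    using mtrace_psd_nonneg psd_congruence[OF P R(1)] psd_congruence[OF Q R(1)] R(2) by auto
  ultimately have "Re (mtrace (R * P * R)) = 0" "Re (mtrace (R * Q * R)) = 0"
    by linarith+
  then have "P * R = 0\<^sub>m d d" "Q * R = 0\<^sub>m d d"
    using psd_mult_eq_zero[OF P R(1)] psd_mult_eq_zero[OF Q R(1)] R(2) by auto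
  then have "R * R = 0\<^sub>m d d"
    using c R by (subst (1) R_def) (simp add: minus_mult_distrib_mat[of _ d d])
  \<comment> \<open>\<open>R\<close> is Hermitian, so \<open>R * R\<close> is the congruence of the
    identity by \<open>R\<close>, and \<open>psd_mult_eq_zero\<close> applies with the identity in
    place of \<open>P\<close>.\<close>
  then have "1\<^sub>m d * R = 0\<^sub>m d d"
    using R by (intro psd_mult_eq_zero[OF psd_one]) auto
  then have "R = 0\<^sub>m d d"
    using R by simp
  then have "R $$ (i,j) = 0" if "i < d" "j < d" for i j
    using that by simp
  then show ?thesis
    using c by (intro eq_matI) (auto simp: R_def)
qed

text \<open>Uniqueness resolves the definite description, so a trace norm is computed by guessing
  the square root and checking it.\<close>

lemma trace_norm_eqI:
  assumes "psd d P" "A \<in> carrier_mat m d" "P * P = dag A * A"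
  shows "trace_norm A = Re (mtrace P)"
proof -
  have d: "dim_col A = d"
    using assms(2) by simp
  have "(THE P. psd d P \<and> P * P = dag A * A) = P"
  proof (rule the_equality)
    fix Q assume "psd d Q \<and> Q * Q = dag A * A"
    then show "Q = P"
      using psd_sqrt_unique[of d Q P] assms(1,3) by argo
  qed (use assms(1,3) in blast)
  then show ?thesis
    by (simp only: trace_norm_def d)
qed

section \<open>Kronecker products\<close>

lemma kron_dim [simp]:
  "dim_row (kron A B) = dim_row A * dim_row B" "dim_col (kron A B) = dim_col A * dim_col B"
  by (auto simp: kron_def)

lemma kron_carrier [simp, intro]:
  "A \<in> carrier_mat m n \<Longrightarrow> B \<in> carrier_mat p q \<Longrightarrow> kron A B \<in> carrier_mat (m * p) (n * q)"
  by (auto simp: kron_def)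

lemma kron_index:
  "i < dim_row A * dim_row B \<Longrightarrow> j < dim_col A * dim_col B \<Longrightarrow>
   kron A B $$ (i,j) = A $$ (i div dim_row B, j div dim_col B) * B $$ (i mod dim_row B, j mod dim_col B)"
  by (auto simp: kron_def)

lemma div_mod_less_mult:
  fixes i m p :: nat
  assumes "i < m * p"
  shows "i div p < m" "i mod p < p"
proof -
  have "p > 0"
    using assms by (cases p) auto
  then show "i div p < m" "i mod p < p"
    using assms by (auto simp: less_mult_imp_div_less)
qed

text \<open>\<open>kron\<close> encodes a pair \<open>(x,y)\<close> of indices as
  \<open>x * q + y\<close>; the range is cut into \<open>n\<close> blocks of length
  \<open>q\<close>.\<close>

lemma sum_div_mod:
  fixes F :: "nat \<Rightarrow> nat \<Rightarrow> 'a::comm_monoid_add"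
  shows "(\<Sum>l<n * q. F (l div q) (l mod q)) = (\<Sum>x<n. \<Sum>y<q. F x y)"
proof (cases "q = 0")
  case False
  have "(\<Sum>l<n * q. F (l div q) (l mod q)) = (\<Sum>x<n. \<Sum>l\<in>{x * q..<x * q + q}. F (l div q) (l mod q))"
    by (rule sum.nat_group[symmetric])
  also have "\<dots> = (\<Sum>x<n. \<Sum>y<q. F x y)"
  proof (rule sum.cong[OF refl])
    fix x
    have "(\<Sum>l\<in>{x * q..<x * q + q}. F (l div q) (l mod q)) = (\<Sum>y\<in>{0..<q}. F ((y + x * q) div q) ((y + x * q) mod q))"
      using sum.shift_bounds_nat_ivl[of "\<lambda>l. F (l div q) (l mod q)" 0 "x * q" q] by (simp add: add.commute)
    also have "\<dots> = (\<Sum>y<q. F x y)"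
      using False by (auto simp: lessThan_atLeast0 intro!: sum.cong)
    finally show "(\<Sum>l\<in>{x * q..<x * q + q}. F (l div q) (l mod q)) = (\<Sum>y<q. F x y)" .
  qed
  finally show ?thesis .
qed simp

lemma kron_mult:
  assumes A: "A \<in> carrier_mat m n" and C: "C \<in> carrier_mat n r"
    and B: "B \<in> carrier_mat p q" and D: "D \<in> carrier_mat q s"
  shows "kron A B * kron C D = kron (A * C) (B * D)"
proof (rule eq_matI)
  fix i j assume "i < dim_row (kron (A * C) (B * D))" "j < dim_col (kron (A * C) (B * D))"
  then have ij: "i < m * p" "j < r * s"
    using assms by auto
  note dm = div_mod_less_mult[OF ij(1)] div_mod_less_mult[OF ij(2)]
  have "(kron A B * kron C D) $$ (i,j) = (\<Sum>l<n * q. kron A B $$ (i,l) * kron C D $$ (l,j))"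
    using assms ij by (subst index_mult_mat_sum) auto
  also have "\<dots> = (\<Sum>l<n * q. (A $$ (i div p, l div q) * B $$ (i mod p, l mod q)) *
      (C $$ (l div q, j div s) * D $$ (l mod q, j mod s)))"
    using assms ij by (intro sum.cong) (auto simp: kron_index)
  also have "\<dots> = (\<Sum>x<n. \<Sum>y<q. (A $$ (i div p, x) * B $$ (i mod p, y)) *
      (C $$ (x, j div s) * D $$ (y, j mod s)))"
    by (rule sum_div_mod)
  also have "\<dots> = (\<Sum>x<n. A $$ (i div p, x) * C $$ (x, j div s)) * (\<Sum>y<q. B $$ (i mod p, y) * D $$ (y, j mod s))"
    by (simp add: sum_product mult_ac)
  also have "\<dots> = (A * C) $$ (i div p, j div s) * (B * D) $$ (i mod p, j mod s)"
    using assms dm by (subst (1 2) index_mult_mat_sum) auto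
  also have "\<dots> = kron (A * C) (B * D) $$ (i,j)"
    using assms ij by (subst kron_index) auto
  finally show "(kron A B * kron C D) $$ (i,j) = kron (A * C) (B * D) $$ (i,j)" .
qed (use assms in auto)

lemma dag_kron: "dag (kron A B) = kron (dag A) (dag B)"
  by (rule eq_matI) (auto simp: kron_index div_mod_less_mult)

lemma kron_one [simp]: "kron (1\<^sub>m m) (1\<^sub>m n) = 1\<^sub>m (m * n)"
proof (rule eq_matI)
  fix i j assume "i < dim_row (1\<^sub>m (m * n))" "j < dim_col (1\<^sub>m (m * n))"
  then have ij: "i < m * n" "j < m * n" by auto
  note dm = div_mod_less_mult[OF ij(1)] div_mod_less_mult[OF ij(2)]
  have "i div n = j div n \<and> i mod n = j mod n \<longleftrightarrow> i = j"
    by (metis div_mult_mod_eq)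
  then show "kron (1\<^sub>m m) (1\<^sub>m n) $$ (i,j) = 1\<^sub>m (m * n) $$ (i,j)"
    using ij dm by (auto simp: kron_index)
qed auto

lemma kron_one_left [simp]: "kron (1\<^sub>m (Suc 0)) A = A"
  by (rule eq_matI) (auto simp: kron_index)

lemma kron_add_left:
  "A \<in> carrier_mat m n \<Longrightarrow> B \<in> carrier_mat m n \<Longrightarrow> kron (A + B) C = kron A C + kron B C"
  by (rule eq_matI) (auto simp: kron_index div_mod_less_mult ring_distribs)

lemma kron_zero_left [simp]: "kron (0\<^sub>m m n) (1\<^sub>m d) = 0\<^sub>m (m * d) (n * d)"
  by (rule eq_matI) (auto simp: kron_index div_mod_less_mult)

lemma tpow_carrier: "A \<in> carrier_mat m n \<Longrightarrow> tpow k A \<in> carrier_mat (m ^ k) (n ^ k)"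
  by (induction k) (auto simp: mult.commute[of m] mult.commute[of n])

lemma tpow_one: "tpow k (1\<^sub>m m) = 1\<^sub>m (m ^ k)"
  by (induction k) (auto simp: mult.commute[of m])

lemma dag_tpow_mult: "A \<in> carrier_mat m n \<Longrightarrow> dag (tpow k A) * tpow k A = tpow k (dag A * A)"
proof (induction k)
  case (Suc k)
  then show ?case
    using tpow_carrier[OF Suc.prems, of k]
    by (simp add: dag_kron kron_mult[of _ "n ^ k" "m ^ k" _ "n ^ k" _ n m _ n])
qed simp

section \<open>Trace distance of the attacked output\<close>

text \<open>The direct sum of a matrix with a real number: a difference of two output states has
  this shape, the scalar being the difference of the rejection weights.\<close>

definition dsum_scalar :: "complex mat \<Rightarrow> real \<Rightarrow> complex mat" where
  "dsum_scalar A c = four_block_mat A (0\<^sub>m (dim_row A) 1) (0\<^sub>m 1 (dim_col A)) (mat 1 1 (\<lambda>_. of_real c))"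

lemma dsum_scalar_carrier [simp, intro]: "A \<in> carrier_mat m n \<Longrightarrow> dsum_scalar A c \<in> carrier_mat (Suc m) (Suc n)"
  by (auto simp: dsum_scalar_def)

lemma dag_dsum_scalar: "dag (dsum_scalar A c) = dsum_scalar (dag A) c"
  by (rule eq_matI) (auto simp: dsum_scalar_def)

lemma dsum_scalar_mult:
  assumes "A \<in> carrier_mat m n" "B \<in> carrier_mat n r"
  shows "dsum_scalar A a * dsum_scalar B b = dsum_scalar (A * B) (a * b)"
proof -
  have "mat 1 1 (\<lambda>_. complex_of_real a) * mat 1 1 (\<lambda>_. complex_of_real b) = mat 1 1 (\<lambda>_. of_real (a * b))"
    by (rule eq_matI) (auto simp: scalar_prod_def)
  moreover have "0\<^sub>m m 1 * 0\<^sub>m 1 r = (0\<^sub>m m r :: complex mat)" "0\<^sub>m 1 n * 0\<^sub>m n 1 = (0\<^sub>m 1 1 :: complex mat)"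
    by auto
  ultimately show ?thesis
    using assms unfolding dsum_scalar_def
    by (subst mult_four_block_mat[of _ m n _ 1 _ 1 _ _ r _ 1]) auto
qed

lemma psd_dsum_scalar:
  assumes "psd d P" "0 \<le> c"
  shows "psd (Suc d) (dsum_scalar P c)"
proof -
  have P: "P \<in> carrier_mat d d" "dag P = P"
    using assms by (auto simp: psd_def)
  have "0 \<le> Re (qform (dsum_scalar P c) v) \<and> Im (qform (dsum_scalar P c) v) = 0"
    if v: "v \<in> carrier_vec (Suc d)" for v
  proof -
    define u where "u = vec d (\<lambda>i. v $ i)"
    have "qform (dsum_scalar P c) v = qform P u + of_real c * (cnj (v $ d) * v $ d)"
      using P v unfolding qform_sum[OF dsum_scalar_carrier[OF P(1)] v]
      by (simp add: qform_sum[of _ d] u_def dsum_scalar_def)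
    moreover have "cnj (v $ d) * v $ d = of_real ((cmod (v $ d))\<^sup>2)"
      by (metis complex_norm_square mult.commute)
    moreover have "0 \<le> Re (qform P u) \<and> Im (qform P u) = 0"
      using assms(1) by (auto simp: psd_iff_qform u_def)
    ultimately show ?thesis
      using assms(2) by simp
  qed
  then show ?thesis
    using P by (auto simp: psd_iff_qform dag_dsum_scalar)
qed

text \<open>The square root of a direct sum is the direct sum of the square roots, and that of
  \<open>c * c\<close> is \<open>\<bar>c\<bar>\<close>.\<close>

lemma trace_norm_dsum_scalar:
  assumes A: "A \<in> carrier_mat d d" and P: "psd d P" "P * P = dag A * A"
  shows "trace_norm (dsum_scalar A c) = Re (mtrace P) + \<bar>c\<bar>"
proof -
  have Pc: "P \<in> carrier_mat d d"
    using P by (simp add: psd_def)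
  have "trace_norm (dsum_scalar A c) = Re (mtrace (dsum_scalar P \<bar>c\<bar>))"
  proof (rule trace_norm_eqI)
    show "psd (Suc d) (dsum_scalar P \<bar>c\<bar>)"
      by (intro psd_dsum_scalar P) simp
    show "dsum_scalar A c \<in> carrier_mat (Suc d) (Suc d)"
      using A by auto
    show "dsum_scalar P \<bar>c\<bar> * dsum_scalar P \<bar>c\<bar> = dag (dsum_scalar A c) * dsum_scalar A c"
      unfolding dag_dsum_scalar dsum_scalar_mult[OF Pc Pc] dsum_scalar_mult[OF dag_carrier[OF A] A] P(2)
      by simp
  qed
  also have "mtrace (dsum_scalar P \<bar>c\<bar>) = mtrace P + of_real \<bar>c\<bar>"
    using Pc by (simp add: mtrace_def dsum_scalar_def)
  finally show ?thesis by simp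
qed

text \<open>The inner \<open>dag V * V\<close> cancels. A square root found in the small space is
  therefore carried to one in the large space, and \<open>mtrace_isometry_sandwich\<close> keeps its
  trace.\<close>

lemma isometry_sandwich_mult:
  assumes V: "V \<in> carrier_mat m n" "dag V * V = 1\<^sub>m n"
    and A: "A \<in> carrier_mat n n" and B: "B \<in> carrier_mat n n"
  shows "(V * A * dag V) * (V * B * dag V) = V * (A * B) * dag V"
proof -
  have "(V * A * dag V) * (V * B * dag V) = V * A * (dag V * V) * (B * dag V)"
    using V(1) A B by (simp add: mult_mat_assoc_dim)
  also have "\<dots> = V * (A * B) * dag V"
    using assms by (simp add: mult_mat_assoc_dim)
  finally show ?thesis .
qed

lemma mtrace_isometry_sandwich:
  assumes V: "V \<in> carrier_mat m n" "dag V * V = 1\<^sub>m n" and A: "A \<in> carrier_mat n n"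
  shows "mtrace (V * A * dag V) = mtrace A"
proof -
  have "mtrace (V * A * dag V) = mtrace (dag V * (V * A))"
    using V A by (intro mtrace_mult_comm[of _ m n]) auto
  also have "dag V * (V * A) = A"
    using V A by (simp flip: assoc_mult_mat[of "dag V" n m V n A n])
  finally show ?thesis .
qed

section \<open>The plus states and the two-by-two block\<close>

lemma ket_carrier [simp]: "ket_plus \<in> carrier_mat 2 1" "ket_plus_alpha \<alpha> \<in> carrier_mat 2 1"
  by (auto simp: ket_plus_def ket_plus_alpha_def)

lemma tpow_ket_plus_carrier: "tpow k ket_plus \<in> carrier_mat (2 ^ k) 1"
  using tpow_carrier[OF ket_carrier(1), of k] by simp

lemma less_two_iff: "i < (2::nat) \<longleftrightarrow> i = 0 \<or> i = 1"
  by auto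

lemma sum_lessThan_two: "(\<Sum>i<(2::nat). f i) = f 0 + f 1"
  by (simp add: numeral_2_eq_2)

lemma inverse_sqrt_two_squared:
  "complex_of_real (1 / sqrt 2) * complex_of_real (1 / sqrt 2) = 1 / 2"
proof -
  have "complex_of_real (1 / sqrt 2) * complex_of_real (1 / sqrt 2) = complex_of_real ((1 / sqrt 2) * (1 / sqrt 2))"
    by (simp only: of_real_mult)
  also have "(1 / sqrt 2) * (1 / sqrt 2) = (1 / 2 :: real)"
    by simp
  finally show ?thesis by simp
qed

lemma dag_ket_plus_mult: "dag ket_plus * ket_plus = 1\<^sub>m 1"
proof (rule eq_matI)
  fix i j assume "i < dim_row (1\<^sub>m 1 :: complex mat)" "j < dim_col (1\<^sub>m 1 :: complex mat)"
  then show "(dag ket_plus * ket_plus) $$ (i,j) = 1\<^sub>m 1 $$ (i,j)"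
    using inverse_sqrt_two_squared
    by (subst index_mult_mat_sum) (auto simp: ket_plus_def sum_lessThan_two)
qed (auto simp: ket_plus_def)

lemma proj_ket_plus_alpha:
  "proj (ket_plus_alpha \<alpha>) = mat 2 2 (\<lambda>(i,j). (if i = j then 1 else if i = 1 then cis \<alpha> else cnj (cis \<alpha>)) / 2)"
proof -
  have c: "cis \<alpha> * cnj (cis \<alpha>) = 1"
    by (metis complex_norm_square norm_cis of_real_1 power_one)
  have c2: "cis \<alpha> * (x * (cnj (cis \<alpha>) * y)) = x * y" for x y
    by (metis c mult.assoc mult.left_commute mult_1)
  have h: "complex_of_real (1 / sqrt 2) * (u * complex_of_real (1 / sqrt 2)) = u / 2" for u
    using inverse_sqrt_two_squared by (metis mult.left_commute mult.right_neutral times_divide_eq_right)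
  show ?thesis
    unfolding proj_def
  proof (rule eq_matI)
    fix i j assume "i < dim_row (mat 2 2 (\<lambda>(i,j). (if i = j then 1 else if i = 1 then cis \<alpha> else cnj (cis \<alpha>)) / 2))"
      "j < dim_col (mat 2 2 (\<lambda>(i,j). (if i = j then 1 else if i = 1 then cis \<alpha> else cnj (cis \<alpha>)) / 2))"
    then show "(ket_plus_alpha \<alpha> * dag (ket_plus_alpha \<alpha>)) $$ (i,j) =
        mat 2 2 (\<lambda>(i,j). (if i = j then 1 else if i = 1 then cis \<alpha> else cnj (cis \<alpha>)) / 2) $$ (i,j)"
      using inverse_sqrt_two_squared h
      by (subst index_mult_mat_sum) (auto simp: ket_plus_alpha_def less_two_iff c2 mult.assoc
          simp del: cis_cnj of_real_divide)
  qed (auto simp: ket_plus_alpha_def)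
qed

lemma ket_plus_alpha_zero: "ket_plus_alpha 0 = ket_plus"
  by (rule eq_matI) (auto simp: ket_plus_alpha_def ket_plus_def)

text \<open>\<open>A\<close> has the eigenvalues \<open>(t + |z|) / 2\<close> and
  \<open>(t - |z|) / 2\<close>, which \<open>t\<close> bounds to be of opposite sign or zero.
  Reversing the sign of the second on the same eigenvectors gives \<open>(|z| + t) / 2\<close> and
  \<open>(|z| - t) / 2\<close>, and \<open>P\<close> is the matrix with this spectrum;
  \<open>t\<close> cancels from its trace.\<close>

lemma psd_abs_two_by_two:
  fixes t :: real and z :: complex
  assumes z: "z \<noteq> 0" and t: "\<bar>t\<bar> \<le> cmod z"
  defines "A \<equiv> mat 2 2 (\<lambda>(i,j). (if i = j then of_real t else if i = 1 then z else cnj z) / 2)"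
  defines "P \<equiv> mat 2 2 (\<lambda>(i,j). (if i = j then of_real (cmod z)
      else of_real (t / cmod z) * (if i = 1 then z else cnj z)) / 2)"
  shows "psd 2 P" "P * P = dag A * A" "mtrace P = of_real (cmod z)"
proof -
  define r where "r = cmod z"
  have r: "r > 0" "\<bar>t\<bar> \<le> r"
    using z t by (auto simp: r_def)
  have zz: "z * cnj z = of_real r * of_real r"
    using complex_norm_square[of z] by (simp add: r_def power2_eq_square)
  have P: "P \<in> carrier_mat 2 2" and A: "A \<in> carrier_mat 2 2"
    by (auto simp: P_def A_def)
  have dagP: "dag P = P" and dagA: "dag A = A"
    by (rule eq_matI; auto simp: P_def A_def)+
  show "mtrace P = of_real (cmod z)"
    by (simp add: mtrace_def P_def sum_lessThan_two)
  have tz: "of_real (t / r) * z * (of_real (t / r) * cnj z) = of_real (t * t)"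
  proof -
    have "of_real (t / r) * z * (of_real (t / r) * cnj z) = of_real (t / r) * of_real (t / r) * (z * cnj z)"
      by (simp only: mult_ac)
    also have "\<dots> = of_real ((t / r) * (t / r) * (r * r))"
      by (simp only: zz of_real_mult)
    also have "(t / r) * (t / r) * (r * r) = t * t"
      using r by (simp add: field_simps)
    finally show ?thesis .
  qed
  have rt: "of_real r * (of_real (t / r) * x) = of_real t * x" for x :: complex
    using r by simp
  show "P * P = dag A * A"
    unfolding dagA
  proof (rule eq_matI)
    fix i j assume "i < dim_row (A * A)" "j < dim_col (A * A)"
    then have ij: "i < 2" "j < 2"
      using A by auto
    have "(P * P) $$ (i,j) = (\<Sum>l<2. P $$ (i,l) * P $$ (l,j))"
      using ij P by (subst index_mult_mat_sum) auto
    also have "\<dots> = (\<Sum>l<2. A $$ (i,l) * A $$ (l,j))"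
      using ij tz zz rt[of z] rt[of "cnj z"]
      by (auto simp: sum_lessThan_two less_two_iff P_def A_def mult_ac simp flip: r_def)
    also have "\<dots> = (A * A) $$ (i,j)"
      using ij A by (subst index_mult_mat_sum) auto
    finally show "(P * P) $$ (i,j) = (A * A) $$ (i,j)" .
  qed (use A P in auto)
  have "0 \<le> Re (qform P v) \<and> Im (qform P v) = 0" if v: "v \<in> carrier_vec 2" for v
  proof -
    \<comment> \<open>The off-diagonal terms of the form are \<open>t (y + cnj y) / 2\<close>. As
      \<open>z / r\<close> is unimodular, they are dominated by the diagonal terms through
      \<open>2 a b <= a^2 + b^2\<close>.\<close>
    define y where "y = cnj (v $ 1) * (z / of_real r) * v $ 0"
    have y: "cmod y = cmod (v $ 0) * cmod (v $ 1)"
      using r by (simp add: y_def norm_mult norm_divide flip: r_def)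
    have sq: "cnj x * x = of_real ((cmod x)\<^sup>2)" for x
      by (metis complex_norm_square mult.commute)
    have "qform P v = (of_real r * (cnj (v $ 0) * v $ 0) + of_real r * (cnj (v $ 1) * v $ 1)
        + of_real t * (y + cnj y)) / 2"
      unfolding qform_sum[OF P v]
      by (simp add: sum_lessThan_two P_def y_def add_divide_distrib distrib_left mult_ac flip: r_def)
    also have "\<dots> = of_real ((r * (cmod (v $ 0))\<^sup>2 + r * (cmod (v $ 1))\<^sup>2 + 2 * t * Re y) / 2)"
      unfolding sq complex_add_cnj by simp
    finally have q: "qform P v = of_real ((r * (cmod (v $ 0))\<^sup>2 + r * (cmod (v $ 1))\<^sup>2 + 2 * t * Re y) / 2)" .
    have "\<bar>t * Re y\<bar> \<le> r * (cmod (v $ 0) * cmod (v $ 1))"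
      unfolding abs_mult using r y abs_Re_le_cmod[of y] by (intro mult_mono) auto
    moreover have "r * (2 * (cmod (v $ 0) * cmod (v $ 1))) \<le> r * ((cmod (v $ 0))\<^sup>2 + (cmod (v $ 1))\<^sup>2)"
      using r sum_squares_bound[of "cmod (v $ 0)" "cmod (v $ 1)"] by (intro mult_left_mono) auto
    ultimately have "0 \<le> r * (cmod (v $ 0))\<^sup>2 + r * (cmod (v $ 1))\<^sup>2 + 2 * t * Re y"
      by (simp add: ring_distribs)
    then show ?thesis
      by (simp add: q)
  qed
  then show "psd 2 P"
    using P dagP by (auto simp: psd_iff_qform)
qed

lemma out_state_diff:
  assumes "\<sigma> \<in> carrier_mat (2 ^ k) (2 ^ k)" "\<tau> \<in> carrier_mat (2 ^ k) (2 ^ k)"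
  shows "out_state k q \<sigma> - out_state k p \<tau> = dsum_scalar (of_real q \<cdot>\<^sub>m \<sigma> - of_real p \<cdot>\<^sub>m \<tau>) (p - q)"
  using assms by (intro eq_matI) (auto simp: out_state_def embX_def bot_proj_def dsum_scalar_def)

text \<open>Tensoring with a fixed \<open>g\<close> is the linear map \<open>kron g 1\<close>, an
  isometry when \<open>g\<close> is a unit vector. It reduces the states on \<open>k\<close> qubits
  to their last qubit.\<close>

lemma proj_kron:
  assumes "g \<in> carrier_mat m 1" "\<phi> \<in> carrier_mat n 1"
  shows "proj (kron g \<phi>) = kron g (1\<^sub>m n) * proj \<phi> * dag (kron g (1\<^sub>m n))"
    and "kron (proj g) (proj \<phi>) = proj (kron g \<phi>)"
proof -
  have V: "kron g (1\<^sub>m n) \<in> carrier_mat (m * n) n"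
    using assms(1) kron_carrier[of g m 1 "1\<^sub>m n" n n] by simp
  have "kron g \<phi> = kron (g * 1\<^sub>m 1) (1\<^sub>m n * \<phi>)"
    using assms by simp
  also have "\<dots> = kron g (1\<^sub>m n) * \<phi>"
    using assms kron_mult[of g m 1 "1\<^sub>m 1" 1 "1\<^sub>m n" n n \<phi> 1] by simp
  finally have eq: "kron g \<phi> = kron g (1\<^sub>m n) * \<phi>" .
  show "proj (kron g \<phi>) = kron g (1\<^sub>m n) * proj \<phi> * dag (kron g (1\<^sub>m n))"
    unfolding eq proj_def using assms V
    by (subst dag_mult) (auto simp: mult_mat_assoc_dim)
  show "kron (proj g) (proj \<phi>) = proj (kron g \<phi>)"
    unfolding proj_def dag_kron using assms
    by (subst kron_mult[of g m 1 _ m \<phi> n 1 _ n]) auto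
qed

text \<open>Law of cosines in half-angle form. It shows that the off-diagonal modulus is at least
  \<open>\<bar>q - p\<bar>\<close> when the last term is nonnegative, as
  \<open>psd_abs_two_by_two\<close> requires.\<close>

lemma cmod_cis_diff:
  "(cmod (of_real q * cis \<alpha> - of_real p))\<^sup>2 = (q - p)\<^sup>2 + 4 * q * p * (sin (\<alpha> / 2))\<^sup>2"
proof -
  have c: "cos \<alpha> = 1 - 2 * (sin (\<alpha> / 2))\<^sup>2"
    using cos_double_sin[of "\<alpha> / 2"] by simp
  have "(cmod (of_real q * cis \<alpha> - of_real p))\<^sup>2 = (q * cos \<alpha> - p)\<^sup>2 + (q * sin \<alpha>)\<^sup>2"
    by (simp add: cmod_power2)
  also have "\<dots> = q\<^sup>2 * ((cos \<alpha>)\<^sup>2 + (sin \<alpha>)\<^sup>2) - 2 * q * p * cos \<alpha> + p\<^sup>2"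
    by (simp add: power2_diff power_mult_distrib distrib_left mult_ac del: sin_cos_squared_add sin_cos_squared_add2)
  also have "\<dots> = q\<^sup>2 - 2 * q * p * (1 - 2 * (sin (\<alpha> / 2))\<^sup>2) + p\<^sup>2"
    unfolding c[symmetric] by simp
  also have "\<dots> = (q - p)\<^sup>2 + 4 * q * p * (sin (\<alpha> / 2))\<^sup>2"
    by (simp add: power2_diff algebra_simps)
  finally show ?thesis .
qed

text \<open>Up to an isometry, the difference is the block of \<open>psd_abs_two_by_two\<close> with
  \<open>t = q - p\<close> and \<open>z = q cis \<alpha> - p\<close>, plus the scalar
  \<open>p - q\<close>. The hypothesis \<open>qp\<close> has the form of a product so that it holds
  at phase 0 for every real \<open>q\<close>, which covers the honest run.\<close>

lemma trace_norm_out_state_diff: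
  assumes k: "k \<ge> 1" and qp: "0 \<le> q * p * (sin (\<alpha> / 2))\<^sup>2"
    and nz: "of_real q * cis \<alpha> \<noteq> complex_of_real p"
  shows "trace_norm (out_state k q (plus_k_alpha k \<alpha>) - out_state k p (plus_k k)) =
    cmod (of_real q * cis \<alpha> - of_real p) + \<bar>q - p\<bar>"
proof -
  define z where "z = of_real q * cis \<alpha> - complex_of_real p"
  define g where "g = tpow (k - 1) ket_plus"
  define V where "V = kron g (1\<^sub>m 2)"
  define A where "A = mat 2 2 (\<lambda>(i,j). (if i = j then of_real (q - p) else if i = 1 then z else cnj z) / 2)"
  define P where "P = mat 2 2 (\<lambda>(i,j). (if i = j then of_real (cmod z)
      else of_real ((q - p) / cmod z) * (if i = 1 then z else cnj z)) / 2)"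
  have pow: "2 ^ (k - 1) * 2 = (2 ^ k :: nat)"
    using k by (cases k) auto
  have g: "g \<in> carrier_mat (2 ^ (k - 1)) 1"
    unfolding g_def by (rule tpow_ket_plus_carrier)
  have gg: "dag g * g = 1\<^sub>m 1"
    using dag_tpow_mult[OF ket_carrier(1), of "k - 1"] by (simp add: g_def dag_ket_plus_mult tpow_one del: One_nat_def)
  have V: "V \<in> carrier_mat (2 ^ k) 2"
    using kron_carrier[OF g one_carrier_mat[of 2]] unfolding V_def pow by simp
  have VV: "dag V * V = 1\<^sub>m 2"
    using g gg by (simp add: V_def dag_kron kron_mult[of "dag g" 1 "2 ^ (k - 1)" g 1 "1\<^sub>m 2" 2 2 "1\<^sub>m 2" 2])
  have nzz: "z \<noteq> 0"
    using nz by (simp add: z_def)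
  have "(q - p)\<^sup>2 \<le> (cmod z)\<^sup>2"
    unfolding z_def cmod_cis_diff using qp by (simp add: mult_ac)
  then have t: "\<bar>q - p\<bar> \<le> cmod z"
    by (metis abs_le_square_iff abs_norm_cancel)
  note P = psd_abs_two_by_two[OF nzz t, folded A_def P_def]
  have Ac: "A \<in> carrier_mat 2 2" "P \<in> carrier_mat 2 2"
    by (auto simp: A_def P_def)
  have A_eq: "A = of_real q \<cdot>\<^sub>m proj (ket_plus_alpha \<alpha>) - of_real p \<cdot>\<^sub>m proj ket_plus"
    unfolding ket_plus_alpha_zero[symmetric] proj_ket_plus_alpha A_def z_def
    by (rule eq_matI) (auto simp: diff_divide_distrib less_two_iff)
  have pr: "proj (ket_plus_alpha \<alpha>) \<in> carrier_mat 2 2" "proj ket_plus \<in> carrier_mat 2 2"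
    unfolding ket_plus_alpha_zero[symmetric] by (auto simp: proj_ket_plus_alpha)
  have s1: "plus_k_alpha k \<alpha> = V * proj (ket_plus_alpha \<alpha>) * dag V"
    unfolding plus_k_alpha_def g_def[symmetric] V_def
    using proj_kron[OF g ket_carrier(2)] by simp
  have "tpow k ket_plus = kron g ket_plus"
    using k by (cases k) (auto simp: g_def)
  then have s2: "plus_k k = V * proj ket_plus * dag V"
    unfolding plus_k_def V_def using proj_kron(1)[OF g ket_carrier(1)] by simp
  have VA: "of_real q \<cdot>\<^sub>m plus_k_alpha k \<alpha> - of_real p \<cdot>\<^sub>m plus_k k = V * A * dag V"
    unfolding s1 s2 A_eq using V pr
    by (simp add: mult_minus_distrib_mat[of V "2 ^ k" 2 _ 2] minus_mult_distrib_mat[of _ "2 ^ k" 2 _ "dag V" "2 ^ k"]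
        mult_smult_distrib[of V "2 ^ k" 2 _ 2] mult_smult_assoc_mat[of _ "2 ^ k" 2 "dag V" "2 ^ k"])
  have "trace_norm (out_state k q (plus_k_alpha k \<alpha>) - out_state k p (plus_k k)) =
      trace_norm (dsum_scalar (V * A * dag V) (p - q))"
    unfolding VA[symmetric] by (subst out_state_diff) (use V pr in \<open>auto simp: s1 s2\<close>)
  also have "\<dots> = Re (mtrace (V * P * dag V)) + \<bar>p - q\<bar>"
  proof (rule trace_norm_dsum_scalar)
    show "V * A * dag V \<in> carrier_mat (2 ^ k) (2 ^ k)"
      using V Ac by auto
    show "psd (2 ^ k) (V * P * dag V)"
      by (rule psd_congruence'[OF P(1) V])
    have "dag (V * A * dag V) = V * dag A * dag V"
      using V Ac by (simp add: dag_mult mult_mat_assoc_dim)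
    then show "V * P * dag V * (V * P * dag V) = dag (V * A * dag V) * (V * A * dag V)"
      using Ac by (simp add: isometry_sandwich_mult[OF V VV] P(2))
  qed
  also have "mtrace (V * P * dag V) = of_real (cmod z)"
    using mtrace_isometry_sandwich[OF V VV Ac(2)] P(3) by simp
  finally show ?thesis
    by (simp add: z_def abs_minus_commute)
qed

text \<open>The bound is independent of \<open>p\<close>, hence passes to the infimum; it is
  attained at \<open>p = q\<close>. For \<open>p >= q\<close> the modulus alone suffices, for
  \<open>p < q\<close> the scalar part \<open>q - p\<close> makes up for what the modulus
  loses.\<close>

lemma trace_norm_out_state_diff_lower_bound:
  assumes k: "k \<ge> 1" and q: "q > 0" and p: "p \<ge> 0" and s: "sin (\<alpha> / 2) > 0"
  shows "2 * q * sin (\<alpha> / 2) \<le> trace_norm (out_state k q (plus_k_alpha k \<alpha>) - out_state k p (plus_k k))"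
proof -
  define s where "s = sin (\<alpha> / 2)"
  define r where "r = cmod (of_real q * cis \<alpha> - of_real p)"
  have s01: "0 < s" "s \<le> 1"
    using s by (auto simp: s_def)
  have r2: "r\<^sup>2 = (q - p)\<^sup>2 + 4 * q * p * s\<^sup>2"
    by (simp add: r_def s_def cmod_cis_diff)
  have "r \<noteq> 0"
  proof
    assume "r = 0"
    then have "(q - p)\<^sup>2 + 4 * q * p * s\<^sup>2 = 0"
      using r2 by simp
    then have "(q - p)\<^sup>2 = 0" "4 * q * p * s\<^sup>2 = 0"
      using q p by (auto simp: add_nonneg_eq_0_iff)
    then show False
      using q s01 by auto
  qed
  then have "of_real q * cis \<alpha> \<noteq> complex_of_real p"
    by (auto simp: r_def)
  then have tn: "trace_norm (out_state k q (plus_k_alpha k \<alpha>) - out_state k p (plus_k k)) = r + \<bar>q - p\<bar>"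
    unfolding r_def using q p by (intro trace_norm_out_state_diff[OF k]) auto
  have r0: "r \<ge> 0"
    by (simp add: r_def)
  have "2 * q * s \<le> r + \<bar>q - p\<bar>"
  proof (cases "q \<le> p")
    case True
    have "(2 * q * s)\<^sup>2 = 4 * q * s\<^sup>2 * q"
      by (simp add: power2_eq_square)
    also have "\<dots> \<le> 4 * q * s\<^sup>2 * p"
      using True q by (intro mult_left_mono) auto
    also have "\<dots> \<le> r\<^sup>2"
      by (simp add: r2 mult_ac)
    finally have "2 * q * s \<le> r"
      using r0 by (rule power2_le_imp_le)
    then show ?thesis by simp
  next
    case False
    \<comment> \<open>\<open>r^2\<close> exceeds \<open>(2 q s - (q - p))^2\<close> by exactly
      \<open>4 q (q - p) (s - s^2)\<close>, so \<open>s <= 1\<close> is what is needed.\<close>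
    have "s * s \<le> s * 1"
      using s01 by (intro mult_left_mono) auto
    then have "4 * q * (q - p) * (s * s) \<le> 4 * q * (q - p) * s"
      using False q by (intro mult_left_mono) auto
    then have "(2 * q * s - (q - p))\<^sup>2 \<le> r\<^sup>2"
      unfolding r2 by (simp add: power2_eq_square algebra_simps)
    then have "2 * q * s - (q - p) \<le> r"
      using r0 by (rule power2_le_imp_le)
    then show ?thesis
      using False by simp
  qed
  then show ?thesis
    by (simp add: tn s_def)
qed

lemma plus_k_alpha_zero: "k \<ge> 1 \<Longrightarrow> plus_k_alpha k 0 = plus_k k"
proof (cases k)
  case (Suc m)
  then show ?thesis
    using proj_kron(2)[OF tpow_ket_plus_carrier ket_carrier(1), of m]
    by (simp add: plus_k_alpha_def plus_k_def ket_plus_alpha_zero)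
qed simp

text \<open>The ideal output is \<open>out_state\<close> with probability 1, so this is the general
  formula at phase 0. The case \<open>q = 1\<close> is excluded because that formula needs a nonzero
  off-diagonal entry.\<close>

lemma trace_norm_honest:
  assumes k: "k \<ge> 1" and "q \<noteq> 1"
  shows "trace_norm (out_state k q (plus_k k) - embX k (plus_k k)) = 2 * \<bar>1 - q\<bar>"
proof -
  have c: "plus_k k \<in> carrier_mat (2 ^ k) (2 ^ k)"
    using tpow_ket_plus_carrier[of k] by (auto simp: plus_k_def proj_def)
  have "embX k (plus_k k) = out_state k 1 (plus_k k)"
    using c by (intro eq_matI) (auto simp: out_state_def embX_def bot_proj_def)
  moreover have "cmod (complex_of_real q - 1) = \<bar>q - 1\<bar>"
    by (metis norm_of_real of_real_1 of_real_diff)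
  ultimately show ?thesis
    using trace_norm_out_state_diff[of k q 1 0] assms
    by (simp add: plus_k_alpha_zero abs_minus_commute)
qed

section \<open>Acceptance probabilities\<close>

lemma density_effect_bounds:
  assumes "density d \<rho>" "effect d M"
  shows "0 \<le> Re (mtrace (M * \<rho>))" "Re (mtrace (M * \<rho>)) \<le> 1"
proof -
  have c: "M \<in> carrier_mat d d" "\<rho> \<in> carrier_mat d d"
    using assms by (auto simp: density_def effect_def psd_def)
  show "0 \<le> Re (mtrace (M * \<rho>))"
    using assms by (intro mtrace_psd_mult_nonneg) (auto simp: density_def effect_def)
  have "0 \<le> Re (mtrace ((1\<^sub>m d - M) * \<rho>))"
    using assms by (intro mtrace_psd_mult_nonneg) (auto simp: density_def effect_def)
  moreover have "(1\<^sub>m d - M) * \<rho> = \<rho> - M * \<rho>"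
    using c by (simp add: minus_mult_distrib_mat[of _ d d])
  moreover have "mtrace (\<rho> - M * \<rho>) = 1 - mtrace (M * \<rho>)"
    using c assms(1) by (simp add: mtrace_minus[of _ d] density_def)
  ultimately show "Re (mtrace (M * \<rho>)) \<le> 1"
    by simp
qed

lemma apply_kraus_carrier:
  assumes "\<forall>K \<in> set Ks. K \<in> carrier_mat dout din" "\<rho> \<in> carrier_mat din din"
  shows "apply_kraus dout Ks \<rho> \<in> carrier_mat dout dout"
  using assms by (induction Ks) (auto simp: apply_kraus_def)

lemma apply_kraus_psd:
  assumes "\<forall>K \<in> set Ks. K \<in> carrier_mat dout din" "psd din \<rho>"
  shows "psd dout (apply_kraus dout Ks \<rho>)"
  using assms by (induction Ks) (auto simp: apply_kraus_def intro!: psd_add psd_zero psd_congruence')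

lemma kraus_sum_carrier:
  assumes "\<forall>K \<in> set Ks. K \<in> carrier_mat dout din"
  shows "foldr (\<lambda>K acc. dag K * K + acc) Ks (0\<^sub>m din din) \<in> carrier_mat din din"
  using assms by (induction Ks) auto

lemma mtrace_apply_kraus:
  assumes "\<forall>K \<in> set Ks. K \<in> carrier_mat dout din" "\<rho> \<in> carrier_mat din din"
  shows "mtrace (apply_kraus dout Ks \<rho>) = mtrace (foldr (\<lambda>K acc. dag K * K + acc) Ks (0\<^sub>m din din) * \<rho>)"
  using assms(1)
proof (induction Ks)
  case Nil
  then show ?case
    using assms(2) by (simp add: apply_kraus_def)
next
  case (Cons K Ks)
  have K: "K \<in> carrier_mat dout din" "\<forall>K \<in> set Ks. K \<in> carrier_mat dout din"
    using Cons.prems by auto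
  let ?S = "foldr (\<lambda>K acc. dag K * K + acc) Ks (0\<^sub>m din din)"
  have S: "?S \<in> carrier_mat din din"
    by (rule kraus_sum_carrier[OF K(2)])
  have R: "apply_kraus dout Ks \<rho> \<in> carrier_mat dout dout"
    by (rule apply_kraus_carrier[OF K(2) assms(2)])
  have "mtrace (apply_kraus dout (K # Ks) \<rho>) = mtrace (K * \<rho> * dag K + apply_kraus dout Ks \<rho>)"
    by (simp add: apply_kraus_def)
  also have "\<dots> = mtrace (K * \<rho> * dag K) + mtrace (apply_kraus dout Ks \<rho>)"
    using K R assms(2) by (intro mtrace_add[of _ dout]) auto
  also have "mtrace (K * \<rho> * dag K) = mtrace (dag K * (K * \<rho>))"
    using K assms(2) by (intro mtrace_mult_comm[of _ dout din]) auto
  also have "dag K * (K * \<rho>) = dag K * K * \<rho>"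
    using K assms(2) by (simp add: mult_mat_assoc_dim)
  also have "mtrace (dag K * K * \<rho>) + mtrace (apply_kraus dout Ks \<rho>) = mtrace (dag K * K * \<rho> + ?S * \<rho>)"
    using K S assms(2) Cons.IH by (subst mtrace_add[of _ din]) auto
  also have "dag K * K * \<rho> + ?S * \<rho> = (dag K * K + ?S) * \<rho>"
    using K S assms(2) by (intro add_mult_distrib_mat[symmetric, of _ din din]) auto
  finally show ?case by simp
qed

lemma kraus_channel_density:
  assumes "kraus_channel din dout Ks" "density din \<rho>"
  shows "density dout (apply_kraus dout Ks \<rho>)"
proof -
  have Ks: "\<forall>K \<in> set Ks. K \<in> carrier_mat dout din"
    using assms by (simp add: kraus_channel_def)
  have \<rho>: "psd din \<rho>" "\<rho> \<in> carrier_mat din din" "mtrace \<rho> = 1"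
    using assms by (auto simp: density_def psd_def)
  show ?thesis
    using apply_kraus_psd[OF Ks \<rho>(1)] mtrace_apply_kraus[OF Ks \<rho>(2)] assms(1) \<rho>(2,3)
    by (simp add: density_def kraus_channel_def)
qed

lemma kraus_channel_kron:
  assumes "kraus_channel din dout Ks"
  shows "kraus_channel (din * d) (dout * d) (map (\<lambda>K. kron K (1\<^sub>m d)) Ks)"
proof -
  have "foldr (\<lambda>K acc. dag K * K + acc) (map (\<lambda>K. kron K (1\<^sub>m d)) Ks) (0\<^sub>m (din * d) (din * d)) =
      kron (foldr (\<lambda>K acc. dag K * K + acc) Ks (0\<^sub>m din din)) (1\<^sub>m d)"
    if "\<forall>K \<in> set Ks. K \<in> carrier_mat dout din" for Ks
    using that
  proof (induction Ks)
    case (Cons K Ks)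
    have K: "K \<in> carrier_mat dout din" "\<forall>K \<in> set Ks. K \<in> carrier_mat dout din"
      using Cons.prems by auto
    have "dag (kron K (1\<^sub>m d)) * kron K (1\<^sub>m d) = kron (dag K * K) (1\<^sub>m d)"
      using K by (simp add: dag_kron kron_mult[of "dag K" din dout K din "1\<^sub>m d" d d "1\<^sub>m d" d])
    then show ?case
      using Cons.IH[OF K(2)]
        kron_add_left[OF mult_carrier_mat[OF dag_carrier[OF K(1)] K(1)] kraus_sum_carrier[OF K(2)]]
      by simp
  qed simp
  then show ?thesis
    using assms by (auto simp: kraus_channel_def)
qed

section \<open>Unitaries and combs map states to states\<close>

lemma unitary_mult:
  assumes "unitary d U" "unitary d V"
  shows "unitary d (U * V)"
proof -
  have c: "U \<in> carrier_mat d d" "V \<in> carrier_mat d d"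
    and u: "dag U * U = 1\<^sub>m d" "U * dag U = 1\<^sub>m d" "dag V * V = 1\<^sub>m d" "V * dag V = 1\<^sub>m d"
    using assms by (auto simp: unitary_def)
  have "dag (U * V) * (U * V) = dag V * (dag U * U) * V"
    using c by (simp add: dag_mult mult_mat_assoc_dim)
  moreover have "U * V * dag (U * V) = U * (V * dag V) * dag U"
    using c by (simp add: dag_mult mult_mat_assoc_dim)
  ultimately show ?thesis
    using c u by (simp add: unitary_def)
qed

lemma unitary_kron:
  assumes "unitary m U" "unitary n V"
  shows "unitary (m * n) (kron U V)"
  using assms
  by (auto simp: unitary_def dag_kron kron_mult[of _ m m _ m _ n n _ n])

lemma unitary_one: "unitary d (1\<^sub>m d)"
  by (simp add: unitary_def)

lemma unitary_density:
  assumes "unitary d U" "density d \<rho>"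
  shows "density d (U * \<rho> * dag U)"
proof -
  have c: "U \<in> carrier_mat d d" "\<rho> \<in> carrier_mat d d" "dag U * U = 1\<^sub>m d"
    using assms by (auto simp: unitary_def density_def psd_def)
  have "psd d (U * \<rho> * dag U)"
    using assms c by (intro psd_congruence') (auto simp: density_def)
  then show ?thesis
    using mtrace_isometry_sandwich[OF c(1,3,2)] assms by (simp add: density_def)
qed

lemma phase_gate_unitary: "unitary 2 (phase_gate \<alpha>)"
proof -
  have c: "cis \<alpha> * cnj (cis \<alpha>) = 1" "cnj (cis \<alpha>) * cis \<alpha> = 1"
    by (simp_all add: cis_cnj cis_mult)
  have "(dag (phase_gate \<alpha>) * phase_gate \<alpha>) = 1\<^sub>m 2" "(phase_gate \<alpha> * dag (phase_gate \<alpha>)) = 1\<^sub>m 2"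
    by (rule eq_matI; auto simp: phase_gate_def index_mult_mat_sum sum_lessThan_two less_two_iff c
        simp del: index_mult_mat(1) cis_cnj)+
  then show ?thesis
    by (simp add: unitary_def phase_gate_def)
qed

lemma A_gate_unitary:
  assumes "k \<ge> 1"
  shows "unitary (2 ^ k) (A_gate k \<alpha>)"
proof -
  have "2 ^ (k - 1) * 2 = (2 ^ k :: nat)"
    using assms by (cases k) auto
  then show ?thesis
    using unitary_kron[OF unitary_one[of "2 ^ (k - 1)"] phase_gate_unitary[of \<alpha>]]
    by (metis A_gate_def tpow_one)
qed

text \<open>\<open>conj_left\<close> recovers the size of the untouched factor as the quotient
  \<open>(m * e) div m\<close>; positivity of \<open>m\<close> makes this \<open>e\<close>.\<close>

lemma conj_left_eq:
  assumes "V \<in> carrier_mat m m" "\<rho> \<in> carrier_mat (m * e) (m * e)" "m > 0"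
  shows "conj_left V \<rho> = kron V (1\<^sub>m e) * \<rho> * dag (kron V (1\<^sub>m e))"
  using assms by (simp add: conj_left_def Let_def)

lemma conj_left_density:
  assumes "unitary m V" "density (m * e) \<rho>" "m > 0"
  shows "density (m * e) (conj_left V \<rho>)"
proof -
  have "conj_left V \<rho> = kron V (1\<^sub>m e) * \<rho> * dag (kron V (1\<^sub>m e))"
    using assms by (intro conj_left_eq) (auto simp: unitary_def density_def psd_def)
  then show ?thesis
    using unitary_density[OF unitary_kron[OF assms(1) unitary_one] assms(2)] by simp
qed

lemma apply_kraus_Y_density:
  assumes "kraus_channel din dout Ks" "density (din * d) \<rho>"
  shows "density (dout * d) (apply_kraus_Y d dout Ks \<rho>)"
  unfolding apply_kraus_Y_def by (rule kraus_channel_density[OF kraus_channel_kron[OF assms(1)] assms(2)])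

lemma comb_part_density:
  assumes "wf_comb k w n D Es" "density (2 ^ (k * w) * dY) \<rho>"
    and "\<And>i. 1 \<le> i \<Longrightarrow> i \<le> n \<Longrightarrow> unitary (2 ^ k) (Vs i)"
    and "j \<le> n"
  shows "density (comb_odim k w n D j * dY) (comb_part dY Es (comb_odim k w n D) Vs j \<rho>)"
  using assms(4)
proof (induction j)
  case 0
  have "kraus_channel (2 ^ (k * w)) (comb_odim k w n D 0) (Es 0)"
    using assms(1) by (auto simp: wf_comb_def comb_idim_def)
  then show ?case
    using assms(2) by (auto intro!: apply_kraus_Y_density)
next
  case (Suc j)
  have o: "comb_odim k w n D j = 2 ^ k * D (Suc j)"
    using Suc.prems by (simp add: comb_odim_def)
  have ch: "kraus_channel (2 ^ k * D (Suc j)) (comb_odim k w n D (Suc j)) (Es (Suc j))"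
    using assms(1) Suc.prems by (auto simp: wf_comb_def comb_idim_def)
  \<comment> \<open>Memory and auxiliary space are grouped into one factor on which the round acts
    trivially.\<close>
  have "density (2 ^ k * (D (Suc j) * dY)) (comb_part dY Es (comb_odim k w n D) Vs j \<rho>)"
    using Suc by (simp add: o mult.assoc)
  then have "density (2 ^ k * D (Suc j) * dY) (conj_left (Vs (Suc j)) (comb_part dY Es (comb_odim k w n D) Vs j \<rho>))"
    unfolding mult.assoc using assms(3)[of "Suc j"] Suc.prems by (intro conj_left_density) auto
  then show ?case
    using apply_kraus_Y_density[OF ch] by simp
qed

lemma comb_odim_last: "comb_odim k w n D n = 2 ^ (k * w)"
  by (simp add: comb_odim_def)

text \<open>Stated for arbitrary unitaries, so that it covers the honest run, the attack and every
  hybrid at every phase.\<close>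

lemma accept_prob_bounds:
  assumes "wf_comb k w n D Es" "density (2 ^ (k * w) * dY) \<rho>" "effect (2 ^ (k * w) * dY) M"
    and "\<And>i. 1 \<le> i \<Longrightarrow> i \<le> n \<Longrightarrow> unitary (2 ^ k) (Vs i)"
  shows "0 \<le> accept_prob k n w dY D Es M \<rho> Vs" "accept_prob k n w dY D Es M \<rho> Vs \<le> 1"
  using density_effect_bounds[OF _ assms(3)] comb_part_density[OF assms(1,2,4) order_refl]
  by (auto simp: accept_prob_def comb_apply_def comb_odim_last)

lemma comb_part_cong:
  assumes "\<And>i. 1 \<le> i \<Longrightarrow> i \<le> j \<Longrightarrow> Vs i = Vs' i"
  shows "comb_part dY Es od Vs j \<rho> = comb_part dY Es od Vs' j \<rho>"
  using assms by (induction j) auto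

section \<open>Dependence on the phase of a single round\<close>

text \<open>The class of the entries of a round's unitary. States contain each such entry also
  conjugated, which leads to the wider class \<open>phase_trig\<close> of trigonometric polynomials
  of degree at most one.\<close>

definition phase_affine :: "(real \<Rightarrow> complex) \<Rightarrow> bool" where
  "phase_affine g \<longleftrightarrow> (\<exists>x y. \<forall>\<beta>. g \<beta> = x + y * cis \<beta>)"

definition phase_trig :: "(real \<Rightarrow> complex) \<Rightarrow> bool" where
  "phase_trig g \<longleftrightarrow> (\<exists>x y z. \<forall>\<beta>. g \<beta> = x + y * cis \<beta> + z * cnj (cis \<beta>))"

lemma phase_affineI: "(\<And>\<beta>. g \<beta> = x + y * cis \<beta>) \<Longrightarrow> phase_affine g"
  by (auto simp: phase_affine_def)

lemma phase_trigI: "(\<And>\<beta>. g \<beta> = x + y * cis \<beta> + z * cnj (cis \<beta>)) \<Longrightarrow> phase_trig g"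
  unfolding phase_trig_def by blast

lemma phase_affine_const: "phase_affine (\<lambda>_. c)"
  by (rule phase_affineI[of _ c 0]) simp

lemma phase_affine_cis: "phase_affine cis"
  by (rule phase_affineI[of _ 0 1]) simp

lemma phase_affine_add:
  assumes "phase_affine f" "phase_affine g"
  shows "phase_affine (\<lambda>\<beta>. f \<beta> + g \<beta>)"
proof -
  obtain x y x' y' where "\<And>\<beta>. f \<beta> = x + y * cis \<beta>" "\<And>\<beta>. g \<beta> = x' + y' * cis \<beta>"
    using assms unfolding phase_affine_def by blast
  then show ?thesis
    by (intro phase_affineI[of _ "x + x'" "y + y'"]) (simp add: distrib_right)
qed

lemma phase_affine_cmult:
  assumes "phase_affine f"
  shows "phase_affine (\<lambda>\<beta>. c * f \<beta>)" "phase_affine (\<lambda>\<beta>. f \<beta> * c)"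
proof -
  obtain x y where "\<And>\<beta>. f \<beta> = x + y * cis \<beta>"
    using assms unfolding phase_affine_def by blast
  then show "phase_affine (\<lambda>\<beta>. c * f \<beta>)" "phase_affine (\<lambda>\<beta>. f \<beta> * c)"
    by (auto intro!: phase_affineI[of _ "c * x" "c * y"] simp: distrib_left distrib_right mult_ac)
qed

lemma phase_affine_sum:
  "(\<And>i. i \<in> I \<Longrightarrow> phase_affine (f i)) \<Longrightarrow> phase_affine (\<lambda>\<beta>. \<Sum>i\<in>I. f i \<beta>)"
  by (induction I rule: infinite_finite_induct) (auto intro: phase_affine_const phase_affine_add)

lemma phase_trig_const: "phase_trig (\<lambda>_. c)"
  by (rule phase_trigI[of _ c 0 0]) simp

lemma phase_trig_add:
  assumes "phase_trig f" "phase_trig g"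
  shows "phase_trig (\<lambda>\<beta>. f \<beta> + g \<beta>)"
proof -
  obtain x y z x' y' z' where "\<And>\<beta>. f \<beta> = x + y * cis \<beta> + z * cnj (cis \<beta>)"
      "\<And>\<beta>. g \<beta> = x' + y' * cis \<beta> + z' * cnj (cis \<beta>)"
    using assms unfolding phase_trig_def by blast
  then show ?thesis
    by (intro phase_trigI[of _ "x + x'" "y + y'" "z + z'"]) (simp add: distrib_right)
qed

lemma phase_trig_cmult:
  assumes "phase_trig f"
  shows "phase_trig (\<lambda>\<beta>. c * f \<beta>)" "phase_trig (\<lambda>\<beta>. f \<beta> * c)"
proof -
  obtain x y z where "\<And>\<beta>. f \<beta> = x + y * cis \<beta> + z * cnj (cis \<beta>)"
    using assms unfolding phase_trig_def by blast
  then show "phase_trig (\<lambda>\<beta>. c * f \<beta>)" "phase_trig (\<lambda>\<beta>. f \<beta> * c)"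
    by (auto intro!: phase_trigI[of _ "c * x" "c * y" "c * z"] simp: distrib_left distrib_right mult_ac)
qed

lemma phase_trig_sum:
  "(\<And>i. i \<in> I \<Longrightarrow> phase_trig (f i)) \<Longrightarrow> phase_trig (\<lambda>\<beta>. \<Sum>i\<in>I. f i \<beta>)"
  by (induction I rule: infinite_finite_induct) (auto intro: phase_trig_const phase_trig_add)

text \<open>The product of the two leading terms is constant, since \<open>cis \<beta>\<close> is
  unimodular; the degree thus stays one.\<close>

lemma phase_trig_affine_mult_cnj:
  assumes "phase_affine f" "phase_affine g"
  shows "phase_trig (\<lambda>\<beta>. f \<beta> * cnj (g \<beta>))"
proof -
  obtain x y x' y' where f: "\<And>\<beta>. f \<beta> = x + y * cis \<beta>" and g: "\<And>\<beta>. g \<beta> = x' + y' * cis \<beta>"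
    using assms unfolding phase_affine_def by blast
  have c: "cis \<beta> * (cnj (cis \<beta>) * w) = w" for \<beta> w
    by (simp add: cis_cnj cis_mult flip: mult.assoc)
  have c1: "cis \<beta> * cnj (cis \<beta>) = 1" for \<beta>
    by (simp add: cis_cnj cis_mult)
  show ?thesis
    by (rule phase_trigI[of _ "x * cnj x' + y * cnj y'" "y * cnj x'" "x * cnj y'"])
       (simp add: f g distrib_left distrib_right mult_ac c c1 del: cis_cnj)
qed

section \<open>Matrices with phase-dependent entries\<close>

definition phase_trig_mat :: "nat \<Rightarrow> nat \<Rightarrow> (real \<Rightarrow> complex mat) \<Rightarrow> bool" where
  "phase_trig_mat m n F \<longleftrightarrow> (\<forall>\<beta>. F \<beta> \<in> carrier_mat m n) \<and> (\<forall>i<m. \<forall>j<n. phase_trig (\<lambda>\<beta>. F \<beta> $$ (i,j)))"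

definition phase_affine_mat :: "nat \<Rightarrow> nat \<Rightarrow> (real \<Rightarrow> complex mat) \<Rightarrow> bool" where
  "phase_affine_mat m n F \<longleftrightarrow> (\<forall>\<beta>. F \<beta> \<in> carrier_mat m n) \<and> (\<forall>i<m. \<forall>j<n. phase_affine (\<lambda>\<beta>. F \<beta> $$ (i,j)))"

lemma phase_trig_mat_const: "A \<in> carrier_mat m n \<Longrightarrow> phase_trig_mat m n (\<lambda>_. A)"
  by (auto simp: phase_trig_mat_def phase_trig_const)

lemma phase_trig_mat_add:
  "phase_trig_mat m n F \<Longrightarrow> phase_trig_mat m n G \<Longrightarrow> phase_trig_mat m n (\<lambda>\<beta>. F \<beta> + G \<beta>)"
  by (auto simp: phase_trig_mat_def carrier_matD[of "G _" m n] intro!: phase_trig_add)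

lemma phase_trig_mat_mult_left:
  assumes A: "A \<in> carrier_mat r m" and F: "phase_trig_mat m n F"
  shows "phase_trig_mat r n (\<lambda>\<beta>. A * F \<beta>)"
proof -
  have Fc: "F \<beta> \<in> carrier_mat m n" for \<beta>
    using F by (simp add: phase_trig_mat_def)
  have "(A * F \<beta>) $$ (i,j) = (\<Sum>l<m. A $$ (i,l) * F \<beta> $$ (l,j))" if "i < r" "j < n" for i j \<beta>
    using A Fc[of \<beta>] that by (subst index_mult_mat_sum) auto
  then show ?thesis
    using F A Fc mult_carrier_mat[OF Fc] by (auto simp: phase_trig_mat_def intro!: phase_trig_sum phase_trig_cmult)
qed

lemma phase_trig_mat_mult_right:
  assumes A: "A \<in> carrier_mat n r" and F: "phase_trig_mat m n F"
  shows "phase_trig_mat m r (\<lambda>\<beta>. F \<beta> * A)"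
proof -
  have Fc: "F \<beta> \<in> carrier_mat m n" for \<beta>
    using F by (simp add: phase_trig_mat_def)
  have "(F \<beta> * A) $$ (i,j) = (\<Sum>l<n. F \<beta> $$ (i,l) * A $$ (l,j))" if "i < m" "j < r" for i j \<beta>
    using A Fc[of \<beta>] that by (subst index_mult_mat_sum) auto
  then show ?thesis
    using F A Fc mult_carrier_mat[OF Fc] by (auto simp: phase_trig_mat_def intro!: phase_trig_sum phase_trig_cmult)
qed

lemma phase_affine_mat_mult_left:
  assumes A: "A \<in> carrier_mat r m" and F: "phase_affine_mat m n F"
  shows "phase_affine_mat r n (\<lambda>\<beta>. A * F \<beta>)"
proof -
  have Fc: "F \<beta> \<in> carrier_mat m n" for \<beta>
    using F by (simp add: phase_affine_mat_def)
  have "(A * F \<beta>) $$ (i,j) = (\<Sum>l<m. A $$ (i,l) * F \<beta> $$ (l,j))" if "i < r" "j < n" for i j \<beta>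
    using A Fc[of \<beta>] that by (subst index_mult_mat_sum) auto
  then show ?thesis
    using F A Fc mult_carrier_mat[OF Fc] by (auto simp: phase_affine_mat_def intro!: phase_affine_sum phase_affine_cmult)
qed

lemma phase_affine_mat_mult_right:
  assumes A: "A \<in> carrier_mat n r" and F: "phase_affine_mat m n F"
  shows "phase_affine_mat m r (\<lambda>\<beta>. F \<beta> * A)"
proof -
  have Fc: "F \<beta> \<in> carrier_mat m n" for \<beta>
    using F by (simp add: phase_affine_mat_def)
  have "(F \<beta> * A) $$ (i,j) = (\<Sum>l<n. F \<beta> $$ (i,l) * A $$ (l,j))" if "i < m" "j < r" for i j \<beta>
    using A Fc[of \<beta>] that by (subst index_mult_mat_sum) auto
  then show ?thesis
    using F A Fc mult_carrier_mat[OF Fc] by (auto simp: phase_affine_mat_def intro!: phase_affine_sum phase_affine_cmult)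
qed

lemma phase_affine_mat_kron_right:
  assumes F: "phase_affine_mat m n F" and A: "A \<in> carrier_mat p q"
  shows "phase_affine_mat (m * p) (n * q) (\<lambda>\<beta>. kron (F \<beta>) A)"
proof -
  have Fc: "F \<beta> \<in> carrier_mat m n" for \<beta>
    using F by (simp add: phase_affine_mat_def)
  have "kron (F \<beta>) A $$ (i,j) = F \<beta> $$ (i div p, j div q) * A $$ (i mod p, j mod q)"
    if "i < m * p" "j < n * q" for i j \<beta>
    using A Fc[of \<beta>] that by (subst kron_index) auto
  then show ?thesis
    using F A Fc by (auto simp: phase_affine_mat_def div_mod_less_mult intro!: phase_affine_cmult)
qed

lemma phase_affine_mat_kron_left:
  assumes F: "phase_affine_mat p q F" and A: "A \<in> carrier_mat m n"
  shows "phase_affine_mat (m * p) (n * q) (\<lambda>\<beta>. kron A (F \<beta>))"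
proof -
  have Fc: "F \<beta> \<in> carrier_mat p q" for \<beta>
    using F by (simp add: phase_affine_mat_def)
  have "kron A (F \<beta>) $$ (i,j) = A $$ (i div p, j div q) * F \<beta> $$ (i mod p, j mod q)"
    if "i < m * p" "j < n * q" for i j \<beta>
    using A Fc[of \<beta>] that by (subst kron_index) auto
  then show ?thesis
    using F A Fc by (auto simp: phase_affine_mat_def div_mod_less_mult intro!: phase_affine_cmult)
qed

lemma phase_trig_mat_conjugation:
  assumes F: "phase_affine_mat m n F" and A: "A \<in> carrier_mat n n"
  shows "phase_trig_mat m m (\<lambda>\<beta>. F \<beta> * A * dag (F \<beta>))"
proof -
  have Fc: "F \<beta> \<in> carrier_mat m n" for \<beta>
    using F by (simp add: phase_affine_mat_def)
  have FA: "phase_affine_mat m n (\<lambda>\<beta>. F \<beta> * A)"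
    by (rule phase_affine_mat_mult_right[OF A F])
  have "(F \<beta> * A * dag (F \<beta>)) $$ (i,j) = (\<Sum>l<n. (F \<beta> * A) $$ (i,l) * cnj (F \<beta> $$ (j,l)))"
    if "i < m" "j < m" for i j \<beta>
    using A Fc[of \<beta>] that by (subst index_mult_mat_sum) auto
  moreover have "F \<beta> * A * dag (F \<beta>) \<in> carrier_mat m m" for \<beta>
    using A Fc[of \<beta>] by auto
  ultimately show ?thesis
    using F FA unfolding phase_trig_mat_def phase_affine_mat_def
    by (auto simp del: index_mult_mat(1) intro!: phase_trig_sum phase_trig_affine_mult_cnj)
qed

lemma phase_affine_mat_A_gate:
  assumes "k \<ge> 1"
  shows "phase_affine_mat (2 ^ k) (2 ^ k) (A_gate k)"
proof -
  have pow: "2 ^ (k - 1) * 2 = (2 ^ k :: nat)"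
    using assms by (cases k) auto
  have "phase_affine_mat 2 2 phase_gate"
    by (auto simp: phase_affine_mat_def phase_gate_def less_two_iff phase_affine_const phase_affine_cis)
  then have "phase_affine_mat (2 ^ (k - 1) * 2) (2 ^ (k - 1) * 2) (\<lambda>\<beta>. kron (1\<^sub>m (2 ^ (k - 1))) (phase_gate \<beta>))"
    by (rule phase_affine_mat_kron_left) simp
  moreover have "A_gate k = (\<lambda>\<beta>. kron (1\<^sub>m (2 ^ (k - 1))) (phase_gate \<beta>))"
    by (simp add: fun_eq_iff A_gate_def tpow_one)
  ultimately show ?thesis
    unfolding pow by simp
qed

lemma phase_trig_mat_apply_kraus:
  assumes "\<forall>K \<in> set Ks. K \<in> carrier_mat dout din" "phase_trig_mat din din F"
  shows "phase_trig_mat dout dout (\<lambda>\<beta>. apply_kraus dout Ks (F \<beta>))"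
  using assms(1)
proof (induction Ks)
  case Nil
  then show ?case
    by (simp add: apply_kraus_def phase_trig_mat_const)
next
  case (Cons K Ks)
  have "phase_trig_mat dout dout (\<lambda>\<beta>. K * F \<beta> * dag K + apply_kraus dout Ks (F \<beta>))"
    using Cons assms(2)
    by (intro phase_trig_mat_add phase_trig_mat_mult_right[of _ din] phase_trig_mat_mult_left[of _ _ din]) auto
  then show ?case
    by (simp add: apply_kraus_def)
qed

lemma phase_trig_mat_apply_kraus_Y:
  assumes "kraus_channel din dout Ks" "phase_trig_mat (din * d) (din * d) F"
  shows "phase_trig_mat (dout * d) (dout * d) (\<lambda>\<beta>. apply_kraus_Y d dout Ks (F \<beta>))"
  unfolding apply_kraus_Y_def
  by (rule phase_trig_mat_apply_kraus[OF _ assms(2)]) (use assms(1) in \<open>auto simp: kraus_channel_def\<close>)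

lemma phase_trig_mat_conj_left:
  assumes V: "V \<in> carrier_mat m m" and F: "phase_trig_mat (m * e) (m * e) F" and m: "m > 0"
  shows "phase_trig_mat (m * e) (m * e) (\<lambda>\<beta>. conj_left V (F \<beta>))"
proof -
  have "conj_left V (F \<beta>) = kron V (1\<^sub>m e) * F \<beta> * dag (kron V (1\<^sub>m e))" for \<beta>
    using F m by (intro conj_left_eq[OF V]) (auto simp: phase_trig_mat_def)
  moreover have "phase_trig_mat (m * e) (m * e) (\<lambda>\<beta>. kron V (1\<^sub>m e) * F \<beta> * dag (kron V (1\<^sub>m e)))"
    using V F by (intro phase_trig_mat_mult_right[of _ "m * e"] phase_trig_mat_mult_left[of _ _ "m * e"]) auto
  ultimately show ?thesis
    by simp
qed

lemma phase_trig_mat_conj_left_phase: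
  assumes V: "phase_affine_mat m m V" and A: "A \<in> carrier_mat (m * e) (m * e)" and m: "m > 0"
  shows "phase_trig_mat (m * e) (m * e) (\<lambda>\<beta>. conj_left (V \<beta>) A)"
proof -
  have "conj_left (V \<beta>) A = kron (V \<beta>) (1\<^sub>m e) * A * dag (kron (V \<beta>) (1\<^sub>m e))" for \<beta>
    using V m by (intro conj_left_eq[OF _ A]) (auto simp: phase_affine_mat_def)
  moreover have "phase_trig_mat (m * e) (m * e) (\<lambda>\<beta>. kron (V \<beta>) (1\<^sub>m e) * A * dag (kron (V \<beta>) (1\<^sub>m e)))"
    using A by (intro phase_trig_mat_conjugation[of _ "m * e"] phase_affine_mat_kron_right[OF V]) auto
  ultimately show ?thesis
    by simp
qed

text \<open>Up to round \<open>i\<close> the state is constant in \<beta>, round \<open>i\<close>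
  conjugates it by a matrix affine in \<open>cis \<beta>\<close>, and all later maps are linear and
  fixed, so they only form linear combinations of the entries.\<close>

lemma phase_trig_mat_comb_part:
  assumes wf: "wf_comb k w n D Es" and \<rho>: "density (2 ^ (k * w) * dY) \<rho>"
    and U: "\<And>i. 1 \<le> i \<Longrightarrow> i \<le> n \<Longrightarrow> unitary (2 ^ k) (Vs i)"
    and V: "phase_affine_mat (2 ^ k) (2 ^ k) V"
    and "j \<le> n"
  shows "phase_trig_mat (comb_odim k w n D j * dY) (comb_odim k w n D j * dY)
    (\<lambda>\<beta>. comb_part dY Es (comb_odim k w n D) (Vs(i := V \<beta>)) j \<rho>)"
  using \<open>j \<le> n\<close>
proof (induction j)
  case 0
  then show ?case
    using comb_part_density[where j = 0 and Vs = Vs, OF wf \<rho> U]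
    by (auto simp: density_def psd_def intro!: phase_trig_mat_const)
next
  case (Suc j)
  let ?c = "\<lambda>Vs. comb_part dY Es (comb_odim k w n D) Vs j \<rho>"
  have o: "comb_odim k w n D j * dY = 2 ^ k * (D (Suc j) * dY)"
    using Suc.prems by (simp add: comb_odim_def)
  have ch: "kraus_channel (2 ^ k * D (Suc j)) (comb_odim k w n D (Suc j)) (Es (Suc j))"
    using wf Suc.prems by (auto simp: wf_comb_def comb_idim_def)
  have "phase_trig_mat (2 ^ k * (D (Suc j) * dY)) (2 ^ k * (D (Suc j) * dY))
      (\<lambda>\<beta>. conj_left ((Vs(i := V \<beta>)) (Suc j)) (?c (Vs(i := V \<beta>))))"
  proof (cases "i = Suc j")
    case True
    \<comment> \<open>The partial comb reads rounds up to \<open>j\<close> only. The state entering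
      round \<open>Suc j\<close> is therefore fixed, and the degree does not exceed one.\<close>
    have "?c (Vs(i := V \<beta>)) = ?c Vs" for \<beta>
      using True by (intro comb_part_cong) auto
    moreover have "?c Vs \<in> carrier_mat (2 ^ k * (D (Suc j) * dY)) (2 ^ k * (D (Suc j) * dY))"
      using comb_part_density[where j = j and Vs = Vs, OF wf \<rho> U] Suc.prems by (simp add: o density_def psd_def)
    ultimately show ?thesis
      using True phase_trig_mat_conj_left_phase[OF V] by simp
  next
    case False
    have "phase_trig_mat (2 ^ k * (D (Suc j) * dY)) (2 ^ k * (D (Suc j) * dY)) (\<lambda>\<beta>. ?c (Vs(i := V \<beta>)))"
      using Suc.IH[OF Suc_leD[OF Suc.prems]] unfolding o .
    moreover have "Vs (Suc j) \<in> carrier_mat (2 ^ k) (2 ^ k)"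
      using U[of "Suc j"] Suc.prems by (simp add: unitary_def)
    ultimately have "phase_trig_mat (2 ^ k * (D (Suc j) * dY)) (2 ^ k * (D (Suc j) * dY))
        (\<lambda>\<beta>. conj_left (Vs (Suc j)) (?c (Vs(i := V \<beta>))))"
      by (intro phase_trig_mat_conj_left) auto
    then show ?thesis
      using False by simp
  qed
  then show ?case
    unfolding comb_part.simps mult.assoc[symmetric] by (rule phase_trig_mat_apply_kraus_Y[OF ch])
qed

lemma Re_phase_trig:
  assumes "phase_trig g"
  obtains u v w where "\<And>\<beta>. Re (g \<beta>) = u + v * cos \<beta> + w * sin \<beta>"
proof -
  obtain x y z where "\<And>\<beta>. g \<beta> = x + y * cis \<beta> + z * cnj (cis \<beta>)"
    using assms unfolding phase_trig_def by blast
  then have "Re (g \<beta>) = Re x + (Re y + Re z) * cos \<beta> + (Im z - Im y) * sin \<beta>" for \<beta>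
    by (simp add: distrib_right left_diff_distrib)
  then show ?thesis
    by (rule that)
qed

lemma accept_prob_phase_trig:
  assumes wf: "wf_comb k w n D Es" and \<rho>: "density (2 ^ (k * w) * dY) \<rho>"
    and M: "effect (2 ^ (k * w) * dY) M"
    and U: "\<And>i. 1 \<le> i \<Longrightarrow> i \<le> n \<Longrightarrow> unitary (2 ^ k) (Vs i)"
    and V: "phase_affine_mat (2 ^ k) (2 ^ k) V"
  obtains u v x where "\<And>\<beta>. accept_prob k n w dY D Es M \<rho> (Vs(i := V \<beta>)) = u + v * cos \<beta> + x * sin \<beta>"
proof -
  let ?d = "2 ^ (k * w) * dY"
  define F where "F = (\<lambda>\<beta>. M * comb_part dY Es (comb_odim k w n D) (Vs(i := V \<beta>)) n \<rho>)"
  have Mc: "M \<in> carrier_mat ?d ?d"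
    using M by (simp add: effect_def psd_def)
  have F: "phase_trig_mat ?d ?d F"
    unfolding F_def using phase_trig_mat_comb_part[OF wf \<rho> U V order_refl]
    by (intro phase_trig_mat_mult_left[OF Mc]) (simp add: comb_odim_last)
  then have "mtrace (F \<beta>) = (\<Sum>i<?d. F \<beta> $$ (i,i))" for \<beta>
    by (simp add: phase_trig_mat_def mtrace_def carrier_matD(1)[of _ ?d ?d])
  then have "phase_trig (\<lambda>\<beta>. mtrace (F \<beta>))"
    using F by (auto simp: phase_trig_mat_def intro!: phase_trig_sum)
  then obtain u v x where "\<And>\<beta>. Re (mtrace (F \<beta>)) = u + v * cos \<beta> + x * sin \<beta>"
    using Re_phase_trig by blast
  then show ?thesis
    by (intro that[of u v x]) (simp add: accept_prob_def comb_apply_def F_def)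
qed

text \<open>The increment factors as \<open>sin (\<alpha> / 2)\<close> times the difference of the values of \<open>f\<close> at two
  antipodal angles, and that difference is at most 1 in modulus.\<close>

lemma trig_increment_bound:
  fixes f :: "real \<Rightarrow> real"
  assumes f: "\<And>\<beta>. f \<beta> = u + v * cos \<beta> + w * sin \<beta>"
    and bounds: "\<And>\<beta>. 0 \<le> f \<beta>" "\<And>\<beta>. f \<beta> \<le> 1"
  shows "\<bar>f \<alpha> - f 0\<bar> \<le> \<bar>sin (\<alpha> / 2)\<bar>"
proof -
  define s c where "s = sin (\<alpha> / 2)" and "c = cos (\<alpha> / 2)"
  \<comment> \<open>The chord from angle 0 to \<alpha> has direction
    \<open>(- sin (\<alpha> / 2), cos (\<alpha> / 2))\<close>, the unit vector at angle
    \<open>\<alpha> / 2 + pi / 2\<close>. Subtracting the value at the antipode removes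
    \<open>u\<close>.\<close>
  have "f (\<alpha> / 2 + pi / 2) - f (\<alpha> / 2 + pi / 2 + pi) = 2 * (w * c - v * s)"
    unfolding f sin_periodic_pi cos_periodic_pi by (simp add: s_def c_def sin_add cos_add)
  moreover have "f \<alpha> - f 0 = s * (2 * (w * c - v * s))"
  proof -
    have cs: "cos \<alpha> = 1 - 2 * s\<^sup>2" "sin \<alpha> = 2 * s * c"
      using cos_double_sin[of "\<alpha> / 2"] sin_double[of "\<alpha> / 2"] by (simp_all add: s_def c_def)
    show ?thesis
      unfolding f cs by (simp add: power2_eq_square algebra_simps)
  qed
  ultimately have "\<bar>f \<alpha> - f 0\<bar> = \<bar>s\<bar> * \<bar>f (\<alpha> / 2 + pi / 2) - f (\<alpha> / 2 + pi / 2 + pi)\<bar>"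
    by (simp add: abs_mult)
  also have "\<dots> \<le> \<bar>s\<bar> * 1"
  proof (rule mult_left_mono)
    show "\<bar>f (\<alpha> / 2 + pi / 2) - f (\<alpha> / 2 + pi / 2 + pi)\<bar> \<le> 1"
      using bounds[of "\<alpha> / 2 + pi / 2"] bounds[of "\<alpha> / 2 + pi / 2 + pi"] by linarith
  qed simp
  finally show ?thesis
    by (simp add: s_def)
qed

text \<open>Hybrid argument: the phase is switched on in one round after the other.\<close>

lemma accept_prob_attack_bound:
  fixes right :: bool
  assumes k: "k \<ge> 1" and wf: "wf_comb k w n D Es" and \<rho>: "density (2 ^ (k * w) * dY) \<rho>"
    and M: "effect (2 ^ (k * w) * dY) M"
    and U: "\<And>i. 1 \<le> i \<Longrightarrow> i \<le> n \<Longrightarrow> unitary (2 ^ k) (T i)"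
  shows "\<bar>accept_prob k n w dY D Es M \<rho> (\<lambda>i. if right then T i * A_gate k \<alpha> else A_gate k \<alpha> * T i) -
     accept_prob k n w dY D Es M \<rho> T\<bar> \<le> real n * \<bar>sin (\<alpha> / 2)\<bar>"
proof -
  define B where "B i \<beta> = (if right then T i * A_gate k \<beta> else A_gate k \<beta> * T i)" for i \<beta>
  define a where "a Vs = accept_prob k n w dY D Es M \<rho> Vs" for Vs
  \<comment> \<open>Rounds not yet attacked carry \<open>B i 0\<close> instead of
    \<open>T i\<close>, so that neighbouring hybrids differ in the phase argument of one round;
    \<open>B_zero\<close> identifies the two later.\<close>
  define H where "H j i = (if i \<le> j then B i \<alpha> else B i 0)" for i j :: nat
  have a_cong: "a Vs = a Vs'" if "\<And>i. 1 \<le> i \<Longrightarrow> i \<le> n \<Longrightarrow> Vs i = Vs' i" for Vs Vs'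
    unfolding a_def accept_prob_def comb_apply_def using comb_part_cong[of n Vs Vs'] that by simp
  have B_unitary: "unitary (2 ^ k) (B i \<beta>)" if "1 \<le> i" "i \<le> n" for i \<beta>
    using U[OF that] A_gate_unitary[OF k] by (auto simp: B_def intro!: unitary_mult)
  have B_zero: "B i 0 = T i" if "1 \<le> i" "i \<le> n" for i
  proof -
    have "A_gate k 0 = 1\<^sub>m (2 ^ k)"
    proof -
      have "phase_gate 0 = 1\<^sub>m 2"
        by (rule eq_matI) (auto simp: phase_gate_def)
      moreover have "2 ^ (k - 1) * 2 = (2 ^ k :: nat)"
        using k by (cases k) auto
      ultimately show ?thesis
        unfolding A_gate_def tpow_one by simp
    qed
    moreover have "T i \<in> carrier_mat (2 ^ k) (2 ^ k)"
      using U[OF that] by (simp add: unitary_def)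
    ultimately show ?thesis
      by (simp add: B_def)
  qed
  have H_unitary: "unitary (2 ^ k) (H j i)" if "1 \<le> i" "i \<le> n" for i j
    using B_unitary[OF that] by (simp add: H_def)
  have step: "\<bar>a (H (Suc j)) - a (H j)\<bar> \<le> \<bar>sin (\<alpha> / 2)\<bar>" if "Suc j \<le> n" for j
  proof -
    have "T (Suc j) \<in> carrier_mat (2 ^ k) (2 ^ k)"
      using U[of "Suc j"] that by (simp add: unitary_def)
    then have V: "phase_affine_mat (2 ^ k) (2 ^ k) (B (Suc j))"
      unfolding B_def using phase_affine_mat_A_gate[OF k]
      by (cases right) (auto intro!: phase_affine_mat_mult_left[of _ "2 ^ k" "2 ^ k"] phase_affine_mat_mult_right[of _ "2 ^ k" "2 ^ k"])
    \<comment> \<open>Phase 0 in round \<open>Suc j\<close> gives hybrid \<open>j\<close>, phase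
      \<alpha> gives hybrid \<open>Suc j\<close>.\<close>
    define f where "f \<beta> = a ((H j)(Suc j := B (Suc j) \<beta>))" for \<beta>
    obtain u v x where f: "\<And>\<beta>. f \<beta> = u + v * cos \<beta> + x * sin \<beta>"
      unfolding f_def a_def
      by (rule accept_prob_phase_trig[where Vs = "H j" and i = "Suc j", OF wf \<rho> M H_unitary V]) blast+
    have u: "unitary (2 ^ k) (((H j)(Suc j := B (Suc j) \<beta>)) i)" if "1 \<le> i" "i \<le> n" for i \<beta>
      using H_unitary[OF that] B_unitary[OF that] by (cases "i = Suc j") auto
    have "0 \<le> f \<beta>" "f \<beta> \<le> 1" for \<beta>
      unfolding f_def a_def
      using accept_prob_bounds[OF wf \<rho> M, of "(H j)(Suc j := B (Suc j) \<beta>)"] u by blast+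
    then have "\<bar>f \<alpha> - f 0\<bar> \<le> \<bar>sin (\<alpha> / 2)\<bar>"
      using trig_increment_bound[OF f] by blast
    moreover have "f \<alpha> = a (H (Suc j))" "f 0 = a (H j)"
      unfolding f_def by (rule a_cong; auto simp: H_def)+
    ultimately show ?thesis
      by simp
  qed
  have "\<bar>a (H j) - a (H 0)\<bar> \<le> real j * \<bar>sin (\<alpha> / 2)\<bar>" if "j \<le> n" for j
    using that
  proof (induction j)
    case (Suc j)
    then show ?case
      using step[of j] by (simp add: distrib_right)
  qed simp
  from this[of n] show ?thesis
    using a_cong[of "H n" "\<lambda>i. B i \<alpha>"] a_cong[of "H 0" T] B_zero
    by (simp add: H_def a_def B_def)
qed

section \<open>Averaging over the rounds and choosing the phase\<close>

theorem mainTheorem5: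
  fixes k :: nat
    and \<Omega> :: "nat pmf"                      \<comment> \<open>distribution of the number n of test rounds\<close>
    and \<omega> :: "nat \<Rightarrow> nat pmf"               \<comment> \<open>distribution of the output round l, given n\<close>
    and T :: "nat \<Rightarrow> nat \<Rightarrow> complex mat"    \<comment> \<open>T n i = test unitary T_i for n test rounds\<close>
    and W :: "nat \<Rightarrow> nat \<Rightarrow> nat"
    and dY :: "nat \<Rightarrow> nat \<Rightarrow> nat"            \<comment> \<open>dimension of the auxiliary space Y\<close>
    and chi :: "nat \<Rightarrow> nat \<Rightarrow> complex mat"
    and \<mu> :: "nat \<Rightarrow> nat \<Rightarrow> complex mat"
    and D :: "nat \<Rightarrow> nat \<Rightarrow> nat \<Rightarrow> nat"       \<comment> \<open>memory dimensions of the comb\<close>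
    and Es :: "nat \<Rightarrow> nat \<Rightarrow> nat \<Rightarrow> complex mat list"  \<comment> \<open>Kraus operators of the comb channels E_j\<close>
    and right :: bool                          \<comment> \<open>attack placement: T_i A_\<alpha> if True, A_\<alpha> T_i if False\<close>
    and \<epsilon>H \<epsilon>D :: real
  defines "N \<equiv> measure_pmf.expectation \<Omega> real"
    and "pH \<equiv> measure_pmf.expectation \<Omega> (\<lambda>n. measure_pmf.expectation (\<omega> n) (\<lambda>l. accept_prob k n (W n l) (dY n l) (D n l) (Es n l) (\<mu> n l) (chi n l) (T n)))"
    and "pD \<equiv> \<lambda>\<alpha>. measure_pmf.expectation \<Omega> (\<lambda>n. measure_pmf.expectation (\<omega> n) (\<lambda>l. accept_prob k n (W n l) (dY n l) (D n l) (Es n l) (\<mu> n l) (chi n l)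
            (\<lambda>i. if right then T n i * A_gate k \<alpha> else A_gate k \<alpha> * T n i)))"
  assumes k_pos: "k \<ge> 1"
    and mean_finite: "integrable (measure_pmf \<Omega>) real"
    and N_ge: "N \<ge> 1"
    and \<omega>_supp: "\<And>n. set_pmf (\<omega> n) \<subseteq> {1..n+1}"
    and T_unitary: "\<And>n i. 1 \<le> i \<Longrightarrow> i \<le> n \<Longrightarrow> unitary (2^k) (T n i)"
    and chi_state: "\<And>n l. density (2^(k * W n l) * dY n l) (chi n l)"
    and \<mu>_effect: "\<And>n l. effect (2^(k * W n l) * dY n l) (\<mu> n l)"
    and comb_wf: "\<And>n l. wf_comb k (W n l) n (D n l) (Es n l)"
    and \<epsilon>H_nonneg: "\<epsilon>H \<ge> 0" and \<epsilon>D_nonneg: "\<epsilon>D \<ge> 0"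
    and honest: "trace_norm (out_state k pH (plus_k k) - embX k (plus_k k)) / 2 \<le> \<epsilon>H"
    and dishonest: "\<And>\<alpha>. (INF p\<in>{0..1::real}. trace_norm (out_state k (pD \<alpha>) (plus_k_alpha k \<alpha>) - out_state k p (plus_k k)) / 2) \<le> \<epsilon>D"
  shows "\<epsilon>H + \<epsilon>D \<ge> 1 / (4 * N)"
proof -
  define aH where "aH n l = accept_prob k n (W n l) (dY n l) (D n l) (Es n l) (\<mu> n l) (chi n l) (T n)" for n l
  define aD where "aD \<alpha> n l = accept_prob k n (W n l) (dY n l) (D n l) (Es n l) (\<mu> n l) (chi n l)
            (\<lambda>i. if right then T n i * A_gate k \<alpha> else A_gate k \<alpha> * T n i)" for \<alpha> n l
  have aH01: "0 \<le> aH n l" "aH n l \<le> 1" for n l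
    unfolding aH_def using accept_prob_bounds[OF comb_wf chi_state \<mu>_effect, where Vs = "T n"] T_unitary by blast+
  have aD01: "0 \<le> aD \<alpha> n l" "aD \<alpha> n l \<le> 1" for \<alpha> n l
  proof -
    have "unitary (2 ^ k) (if right then T n i * A_gate k \<alpha> else A_gate k \<alpha> * T n i)" if "1 \<le> i" "i \<le> n" for i
      using T_unitary[OF that] A_gate_unitary[OF k_pos] by (auto intro: unitary_mult)
    then show "0 \<le> aD \<alpha> n l" "aD \<alpha> n l \<le> 1"
      unfolding aD_def
      using accept_prob_bounds[OF comb_wf chi_state \<mu>_effect, where Vs = "\<lambda>i. if right then T n i * A_gate k \<alpha> else A_gate k \<alpha> * T n i"]
      by blast+
  qed
  have int: "integrable (measure_pmf q) g" if "\<And>x. 0 \<le> g x" "\<And>x. g x \<le> 1" for q :: "nat pmf" and g :: "nat \<Rightarrow> real"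
    using that by (intro measure_pmf.integrable_const_bound[of _ 1]) auto
  have exp01: "0 \<le> measure_pmf.expectation q g" "measure_pmf.expectation q g \<le> 1"
    if "\<And>x. 0 \<le> g x" "\<And>x. g x \<le> 1" for q :: "nat pmf" and g :: "nat \<Rightarrow> real"
    using that int[OF that] by (auto intro!: integral_nonneg_AE measure_pmf.integral_le_const)
  \<comment> \<open>The maximiser of \<open>s (1 - N s)\<close>, with maximum
    \<open>1 / (4 N)\<close>. As \<open>N >= 1\<close>, it lies in the domain of
    \<open>arcsin\<close>.\<close>
  define s where "s = 1 / (2 * N)"
  define \<alpha> where "\<alpha> = 2 * arcsin s"
  have s: "0 < s" "s \<le> 1"
    using N_ge by (auto simp: s_def)
  have sin: "sin (\<alpha> / 2) = s"
    using s by (simp add: \<alpha>_def)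
  define eH where "eH n = measure_pmf.expectation (\<omega> n) (aH n)" for n
  define eD where "eD n = measure_pmf.expectation (\<omega> n) (aD \<alpha> n)" for n
  have pH: "pH = measure_pmf.expectation \<Omega> eH"
    unfolding pH_def eH_def aH_def ..
  have pD: "pD \<alpha> = measure_pmf.expectation \<Omega> eD"
    unfolding pD_def eD_def aD_def ..
  have le: "eH n - real n * s \<le> eD n" for n
  proof -
    have "measure_pmf.expectation (\<omega> n) (\<lambda>l. aH n l - real n * s) \<le> measure_pmf.expectation (\<omega> n) (aD \<alpha> n)"
    proof (rule integral_mono)
      show "integrable (measure_pmf (\<omega> n)) (\<lambda>l. aH n l - real n * s)"
        using int[OF aH01] by simp
      show "integrable (measure_pmf (\<omega> n)) (aD \<alpha> n)"
        by (rule int[OF aD01])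
      fix l
      have "\<bar>aD \<alpha> n l - aH n l\<bar> \<le> real n * \<bar>sin (\<alpha> / 2)\<bar>"
        unfolding aD_def aH_def
        by (rule accept_prob_attack_bound[OF k_pos comb_wf chi_state \<mu>_effect T_unitary])
      then show "aH n l - real n * s \<le> aD \<alpha> n l"
        using sin s by simp
    qed
    then show ?thesis
      using int[OF aH01] by (simp add: eH_def eD_def)
  qed
  have eH01: "0 \<le> eH n" "eH n \<le> 1" for n
    unfolding eH_def by (rule exp01[OF aH01])+
  have eD01: "0 \<le> eD n" "eD n \<le> 1" for n
    unfolding eD_def by (rule exp01[OF aD01])+
  \<comment> \<open>The hybrid loss \<open>real n * s\<close> is unbounded in \<open>n\<close>; the
    finite mean makes it integrable, with expectation \<open>N * s\<close>.\<close>
  have "measure_pmf.expectation \<Omega> (\<lambda>n. eH n - real n * s) \<le> measure_pmf.expectation \<Omega> eD"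
    using int[OF eH01] int[OF eD01] mean_finite le by (intro integral_mono) auto
  then have hybrid: "pH - N * s \<le> pD \<alpha>"
    using int[OF eH01] mean_finite by (simp add: pH pD N_def)
  have Ns: "N * s = 1 / 2"
    using N_ge by (simp add: s_def)
  have honest_bound: "1 - pH \<le> \<epsilon>H"
  proof (cases "pH = 1")
    case False
    then show ?thesis
      using honest trace_norm_honest[OF k_pos False] by simp
  qed (use \<epsilon>H_nonneg in simp)
  have dishonest_bound: "pD \<alpha> * s \<le> \<epsilon>D"
  \<comment> \<open>The uniform trace-norm bound needs a positive acceptance probability; otherwise
    the left side is at most 0.\<close>
  proof (cases "pD \<alpha> > 0")
    case True
    have "pD \<alpha> * s \<le> (INF p\<in>{0..1::real}. trace_norm (out_state k (pD \<alpha>) (plus_k_alpha k \<alpha>) - out_state k p (plus_k k)) / 2)"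
    proof (rule cINF_greatest)
      fix p :: real assume "p \<in> {0..1}"
      then show "pD \<alpha> * s \<le> trace_norm (out_state k (pD \<alpha>) (plus_k_alpha k \<alpha>) - out_state k p (plus_k k)) / 2"
        using trace_norm_out_state_diff_lower_bound[OF k_pos True, of p \<alpha>] s by (simp add: sin)
    qed simp
    then show ?thesis
      using dishonest[of \<alpha>] by linarith
  next
    case False
    then have "pD \<alpha> * s \<le> 0"
      using s by (simp add: mult_nonpos_nonneg)
    then show ?thesis
      using \<epsilon>D_nonneg by linarith
  qed
  \<comment> \<open>Since \<open>N * s = 1 / 2\<close>, the attack is accepted with probability at
    least \<open>pH - 1 / 2\<close>, and \<open>pH >= 1 - \<epsilon>H\<close>.\<close>
  have "(1 / 2 - \<epsilon>H) * s \<le> pD \<alpha> * s"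
    using hybrid honest_bound Ns s by (intro mult_right_mono) auto
  then have "s / 2 \<le> \<epsilon>H * s + \<epsilon>D"
    using dishonest_bound by (simp add: left_diff_distrib)
  moreover have "\<epsilon>H * s \<le> \<epsilon>H"
    using s \<epsilon>H_nonneg by (simp add: mult_left_le)
  moreover have "s / 2 = 1 / (4 * N)"
    by (simp add: s_def)
  ultimately show ?thesis
    by linarith
qed

end
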